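(* Every planar graph without $4$-cycles and without $6$-cycles is DP-$B_{A}$-$3$-colorable.
   Context: All graphs are finite, simple and undirected. A $k$-assignment $L$ for a graph $G$ assigns to each vertex $u$ a list $L(u)$ of $k$ colours, the colours being $1,2,\dots,k$. A cover $H$ of $G$ (with respect to $L$) is a graph with vertex set $\{(u,c): u\in V(G), c\in L(u)\}$ and edge set $\bigcup_{uv\in E(G)}\mathscr{M}_{uv}$, where each $\mathscr{M}_{uv}$ is a matching (not necessarily perfect) between $\{u\}\times L(u)$ and $\{v\}\times L(v)$; there are no other edges. A transversal of $H$ is a set $T\subseteq V(H)$ with $|T\cap(\{u\}\times L(u))|=1$ for every $u\in V(G)$. A transversal $T$ is a DP-$B_{A}$-coloring if the vertices of $T$ can be linearly ordered ("from left to right") such that: (1) each $(v,1)\in T$ has no $H$-neighbour in $T$ to its left; (2) each $(v,c)\in T$ with $c\neq 1$ has at most one $H$-neighbour in $T$ to its left, and that neighbour (if it exists) is adjacent in $H$ to at most one vertex of $T$ lying to the left of $(v,c)$. A graph $G$ is DP-$B_{A}$-$3$-colorable if every cover $H$ of $G$ with respect to every $3$-assignment $L$ has a DP-$B_{A}$-coloring. *)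

theory Defs
  imports "HOL-Analysis.Analysis" "Graph_Theory.Pair_Digraph"
begin

text \<open>
  A finite simple undirected graph is a \<^locale>\<open>pair_graph\<close>: the edge \<open>uv\<close> is represented by the
  two arcs \<open>(u, v)\<close> and \<open>(v, u)\<close>. A \<open>k\<close>-cycle with \<open>k \<ge> 3\<close> is a \<open>cycle\<close> \<open>p\<close> with \<open>length p = k\<close>;
  it need not be induced. (The two arcs of a single edge also form a \<open>cycle\<close>, but one of length 2.)
\<close>

definition has_cycle_of_length :: "'a pair_pre_digraph \<Rightarrow> nat \<Rightarrow> bool" where
  "has_cycle_of_length G k \<longleftrightarrow> (\<exists>p. pre_digraph.cycle (with_proj G) p \<and> length p = k)"


subsection \<open>Planarity\<close>

text \<open>
  A drawing without crossings: \<open>\<phi>\<close> places the vertices at distinct points of the plane and \<open>\<gamma>\<close> draws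
  the edges as simple arcs. The two orientations of an edge are drawn as the same curve, traversed in
  opposite directions. The last two conditions say that no edge passes through a vertex other
  than its ends, and that two different edges meet at most in a common end.
\<close>

definition plane_drawing ::
  "'a pair_pre_digraph \<Rightarrow> ('a \<Rightarrow> complex) \<Rightarrow> ('a \<times> 'a \<Rightarrow> real \<Rightarrow> complex) \<Rightarrow> bool" where
  "plane_drawing G \<phi> \<gamma> \<longleftrightarrow>
     inj_on \<phi> (pverts G) \<and>
     (\<forall>(u, v) \<in> parcs G.
        arc (\<gamma> (u, v)) \<and> pathstart (\<gamma> (u, v)) = \<phi> u \<and> pathfinish (\<gamma> (u, v)) = \<phi> v \<and>
        \<gamma> (v, u) = reversepath (\<gamma> (u, v))) \<and>
     (\<forall>(u, v) \<in> parcs G. \<forall>w \<in> pverts G. \<phi> w \<in> path_image (\<gamma> (u, v)) \<longrightarrow> w = u \<or> w = v) \<and>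
     (\<forall>(u, v) \<in> parcs G. \<forall>(x, y) \<in> parcs G. {u, v} \<noteq> {x, y} \<longrightarrow>
        path_image (\<gamma> (u, v)) \<inter> path_image (\<gamma> (x, y)) \<subseteq> \<phi> ` ({u, v} \<inter> {x, y}))"

definition planar :: "'a pair_pre_digraph \<Rightarrow> bool" where
  "planar G \<longleftrightarrow> (\<exists>\<phi> \<gamma>. plane_drawing G \<phi> \<gamma>)"


subsection \<open>List assignments, covers and transversals\<close>

definition assignment :: "nat \<Rightarrow> 'a pair_pre_digraph \<Rightarrow> ('a \<Rightarrow> nat set) \<Rightarrow> bool" where
  "assignment k G L \<longleftrightarrow> (\<forall>u \<in> pverts G. L u \<subseteq> {1..k} \<and> card (L u) = k)"

definition matching_between :: "'b set \<Rightarrow> 'b set \<Rightarrow> 'b rel \<Rightarrow> bool" where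
  "matching_between A B M \<longleftrightarrow> M \<subseteq> A \<times> B \<and> single_valued M \<and> single_valued (M\<inverse>)"

text \<open>
  \<open>M u v\<close> is the matching for the edge \<open>uv\<close>, oriented from \<open>u\<close> to \<open>v\<close>; hence \<open>M v u\<close> is
  its converse.
\<close>

definition cover ::
  "'a pair_pre_digraph \<Rightarrow> ('a \<Rightarrow> nat set) \<Rightarrow> ('a \<times> nat) pair_pre_digraph \<Rightarrow> bool" where
  "cover G L H \<longleftrightarrow>
     pverts H = (SIGMA u:pverts G. L u) \<and>
     (\<exists>M. (\<forall>(u, v) \<in> parcs G.
             matching_between ({u} \<times> L u) ({v} \<times> L v) (M u v) \<and> M v u = (M u v)\<inverse>) \<and>
          parcs H = (\<Union>(u, v) \<in> parcs G. M u v))"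

lemma pair_graph_cover:
  assumes "pair_graph G" and "assignment k G L" and "cover G L H"
  shows "pair_graph H"
proof -
  interpret G: pair_graph G by fact
  have V: "pverts H = (SIGMA u:pverts G. L u)" using assms(3) by (simp add: cover_def)
  obtain M where M': "\<forall>(u, v) \<in> parcs G.
             matching_between ({u} \<times> L u) ({v} \<times> L v) (M u v) \<and> M v u = (M u v)\<inverse>"
    and A: "parcs H = (\<Union>(u, v) \<in> parcs G. M u v)"
    using assms(3) unfolding cover_def by (elim conjE exE)
  have M: "M u v \<subseteq> ({u} \<times> L u) \<times> ({v} \<times> L v) \<and> M v u = (M u v)\<inverse>"
    if "(u, v) \<in> parcs G" for u v
    using bspec[OF M' that] by (simp add: matching_between_def)
  have ends: "x \<in> pverts H \<and> y \<in> pverts H \<and> x \<noteq> y \<and> (y, x) \<in> parcs H"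
    if xy: "(x, y) \<in> parcs H" for x y
  proof -
    obtain u v where uv: "(u, v) \<in> parcs G" "(x, y) \<in> M u v" using xy A by auto
    have "x \<in> {u} \<times> L u" "y \<in> {v} \<times> L v" "(y, x) \<in> M v u"
      using M[OF uv(1)] uv(2) by blast+
    moreover have "(v, u) \<in> parcs G" "u \<noteq> v" "u \<in> pverts G" "v \<in> pverts G"
      using G.arcs_symmetric[OF uv(1)] G.no_loops'[OF uv(1)] G.wellformed'[OF uv(1)] by simp_all
    ultimately show ?thesis unfolding A V by blast
  qed
  have "finite (L u)" if "u \<in> pverts G" for u
    using assms(2) that unfolding assignment_def by (meson finite_atLeastAtMost finite_subset)
  then have finV: "finite (pverts H)"
    unfolding V using G.pair_finite_verts by (intro finite_SigmaI)
  have "parcs H \<subseteq> pverts H \<times> pverts H" using ends by (intro subrelI) blast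
  then have "finite (parcs H)" using finV by (meson finite_SigmaI finite_subset)
  moreover have "symmetric (with_proj H)"
    unfolding symmetric_def with_proj_simps by (rule symI) (use ends in blast)
  moreover have "fst e \<in> pverts H \<and> snd e \<in> pverts H \<and> fst e \<noteq> snd e" if "e \<in> parcs H" for e
    using ends[of "fst e" "snd e"] that by simp
  ultimately show ?thesis
    using finV by unfold_locales blast+
qed

definition transversal ::
  "'a pair_pre_digraph \<Rightarrow> ('a \<Rightarrow> nat set) \<Rightarrow> ('a \<times> nat) pair_pre_digraph \<Rightarrow> ('a \<times> nat) set \<Rightarrow> bool"
where
  "transversal G L H T \<longleftrightarrow>
     T \<subseteq> pverts H \<and> (\<forall>u \<in> pverts G. card (T \<inter> ({u} \<times> L u)) = 1)"


subsection \<open>\<open>DP-B\<^sub>A\<close>-colorings\<close>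

text \<open>
  For a linear order \<open>r\<close>, the pair \<open>(y, x) \<in> r\<close> means that \<open>y\<close> equals \<open>x\<close> or lies to the left of \<open>x\<close>.
\<close>

definition left_of :: "'b set \<Rightarrow> 'b rel \<Rightarrow> 'b \<Rightarrow> 'b set" where
  "left_of T r x = {y \<in> T. (y, x) \<in> r \<and> y \<noteq> x}"

definition neighbours :: "'b pair_pre_digraph \<Rightarrow> 'b \<Rightarrow> 'b set" where
  "neighbours H x = {y. (x, y) \<in> parcs H}"

text \<open>
  In the last condition \<open>y\<close> is a neighbour to the left of \<open>(v, c)\<close>, and the neighbours of \<open>y\<close>
  are counted among all vertices to the left of \<open>(v, c)\<close>, not only those to the left of \<open>y\<close>.
\<close>

definition DP_BA_coloring :: "('a \<times> nat) pair_pre_digraph \<Rightarrow> ('a \<times> nat) set \<Rightarrow> bool" where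
  "DP_BA_coloring H T \<longleftrightarrow>
     (\<exists>r. linear_order_on T r \<and>
        (\<forall>v. (v, 1) \<in> T \<longrightarrow> neighbours H (v, 1) \<inter> left_of T r (v, 1) = {}) \<and>
        (\<forall>v c. (v, c) \<in> T \<and> c \<noteq> 1 \<longrightarrow>
           card (neighbours H (v, c) \<inter> left_of T r (v, c)) \<le> 1 \<and>
           (\<forall>y \<in> neighbours H (v, c) \<inter> left_of T r (v, c).
              card (neighbours H y \<inter> left_of T r (v, c)) \<le> 1)))"

definition DP_BA_colorable :: "nat \<Rightarrow> 'a pair_pre_digraph \<Rightarrow> bool" where
  "DP_BA_colorable k G \<longleftrightarrow>
     (\<forall>L H. assignment k G L \<and> cover G L H \<longrightarrow>
        (\<exists>T. transversal G L H T \<and> DP_BA_coloring H T))"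

end

theory Submission
  imports Defs
begin

text \<open>
  A \<open>DP-B\<^sub>A\<close>-coloring is a transversal inducing a union of paths, each with at most one vertex of
  colour 1. In a minimal counterexample all degrees are at least 3, and if two 3-vertices \<open>u\<close>, \<open>v\<close>
  are adjacent then all their other neighbours have degree at least 5: color the rest with as few
  cover edges as possible, so that a neighbour \<open>w\<close> of degree at most 4 is not an inner vertex of its
  path; then one of \<open>u\<close>, \<open>v\<close> can be appended to the path of \<open>w\<close>.

  Such a graph is not planar. Euler's inequality says that the sum of
  \<open>1/d(u) + 1/d(v) + s(uv) - 1\<close> over all edges is at least 2, where \<open>s(e)\<close> is the sum of
  \<open>1/length\<close> over the two faces at \<open>e\<close>, up to a redistribution within faces of length 6. Excluding 4- and 6-cycles makes triangles edge-disjoint from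
  each other and from 5-cycles, so that \<open>s(e)\<close> is at most \<open>1/3 + 1/7\<close> on triangles,
  \<open>2/5\<close> elsewhere, and \<open>2/7\<close> on edges in neither triangles nor 5-cycles. Crediting every edge to
  its ends of degree 3 shows that the sum is not positive.

  Faces are the components of the complement of the drawing. By Janiszewski's theorem two points are
  separated by the drawing only if they are separated by one of its cycles; with the Jordan curve
  theorem this gives all that is used about faces.
\<close>

section \<open>Paths and cycles as edge sets\<close>

text \<open>The constants leave almost no slack. A vertex of degree 3 on a triangle sees shares of
  at most \<open>10/21\<close>, \<open>10/21\<close> and \<open>2/7\<close>. If it has no neighbour
  of degree 3, its edges bring at most \<open>26/21 - 3 * 5/12 = -1/84\<close>; if the neighbour
  along the third edge has degree 3, they bring at most
  \<open>1/7 - 1/6 + 20/21 - 2 * 7/15 = -1/210\<close>. With degree 4 in place of 5 in the reducible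
  configuration, the latter bound would be \<open>2/21\<close>. The obstacle is a face bounded by
  two triangles: equal shares of \<open>1/6\<close> would allow \<open>1/3 + 1/6\<close> on a
  triangle edge, and \<open>1/2 + 1/2 + 2/7 - 5/4\<close> is positive. The redistribution works
  because the two triangles cannot both have a face of length 3 on their other side, which in turn
  follows from there being at least four faces. The graph may be disconnected or have cut vertices.
  So a face is not expected to be bounded by a single cycle, its length counts only edges that lie
  on cycles, and Euler's formula enters as an inequality.\<close>

fun pedges :: "'a list \<Rightarrow> 'a set set" where
  "pedges (x # y # zs) = insert {x, y} (pedges (y # zs))"
| "pedges _ = {}"

text \<open>As edge sets, cycles can be compared with face boundaries and drawn as unions of edges;
  the witnessing list is determined only up to rotation and reversal. The length bound keeps the
  closing edge apart from the edges of the path.\<close>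

definition gcycle :: "'a set set \<Rightarrow> bool" where
  "gcycle C \<longleftrightarrow> (\<exists>xs. 3 \<le> length xs \<and> distinct xs \<and> C = insert {last xs, hd xs} (pedges xs))"

definition adjacency :: "'a set set \<Rightarrow> 'a rel" where
  "adjacency S = {(x, y). {x, y} \<in> S}"

lemma pedges_append:
  "xs \<noteq> [] \<Longrightarrow> ys \<noteq> [] \<Longrightarrow> pedges (xs @ ys) = insert {last xs, hd ys} (pedges xs \<union> pedges ys)"
proof (induction xs rule: pedges.induct)
  case ("2_2" v)
  then show ?case by (cases ys) auto
qed auto

lemma pedges_rev: "pedges (rev xs) = pedges xs"
proof (induction xs rule: pedges.induct)
  case (1 x y zs)
  have "pedges (rev (x # y # zs)) = pedges (rev (y # zs) @ [x])" by simp
  also have "\<dots> = insert {y, x} (pedges (y # zs))"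
    using 1 by (subst pedges_append) auto
  finally show ?case by (simp add: insert_commute)
qed auto

lemma pedges_subset_set: "e \<in> pedges xs \<Longrightarrow> e \<subseteq> set xs"
  by (induction xs rule: pedges.induct) auto

lemma finite_pedges [simp]: "finite (pedges xs)"
  by (induction xs rule: pedges.induct) auto

lemma pedges_conv: "e \<in> pedges xs \<Longrightarrow> \<exists>as bs. xs = as @ bs \<and> as \<noteq> [] \<and> bs \<noteq> [] \<and> e = {last as, hd bs}"
proof (induction xs rule: pedges.induct)
  case (1 x y zs)
  show ?case
  proof (cases "e = {x, y}")
    case True
    then show ?thesis by (intro exI[of _ "[x]"] exI[of _ "y # zs"]) auto
  next
    case False
    then obtain as bs where "y # zs = as @ bs" "as \<noteq> []" "bs \<noteq> []" "e = {last as, hd bs}"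
      using 1 by auto
    then show ?thesis by (intro exI[of _ "x # as"] exI[of _ bs]) auto
  qed
qed auto

lemma card_pedges: "distinct xs \<Longrightarrow> card (pedges xs) = length xs - 1"
proof (induction xs rule: pedges.induct)
  case (1 x y zs)
  have "{x, y} \<notin> pedges (y # zs)" using 1(2) pedges_subset_set[of "{x, y}" "y # zs"] by auto
  then show ?case using 1 by simp
qed auto

lemma closing_edge_notin_pedges:
  assumes "distinct xs" "3 \<le> length xs"
  shows "{last xs, hd xs} \<notin> pedges xs"
proof
  assume "{last xs, hd xs} \<in> pedges xs"
  then obtain as bs where ab: "xs = as @ bs" "as \<noteq> []" "bs \<noteq> []" "{last xs, hd xs} = {last as, hd bs}"
    using pedges_conv by blast
  have "last bs \<in> set bs" "hd bs \<in> set bs" "hd as \<in> set as" "last as \<in> set as" using ab by auto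
  moreover have "set as \<inter> set bs = {}" using ab(1) assms(1) by auto
  moreover have "{last bs, hd as} = {last as, hd bs}" using ab by simp
  ultimately have eq: "last bs = hd bs" "hd as = last as" by (auto simp: doubleton_eq_iff)
  have "length bs = 1"
    using eq ab assms(1) by (cases bs) (auto split: if_splits)
  moreover have "length as = 1"
    using eq ab assms(1) by (cases as) (auto split: if_splits)
  ultimately show False using ab assms(2) by simp
qed

text \<open>The cycle is cut open at a prescribed edge: a rotation of the witnessing list makes this
  edge the closing one, and a reversal corrects the orientation.\<close>

lemma gcycle_path_through:
  assumes "gcycle C" "{a, b} \<in> C"
  obtains xs where "distinct xs" "3 \<le> length xs" "hd xs = a" "last xs = b"
    "C = insert {a, b} (pedges xs)" "{a, b} \<notin> pedges xs"
proof -
  obtain ys where ys: "3 \<le> length ys" "distinct ys" "C = insert {last ys, hd ys} (pedges ys)"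
    using assms by (auto simp: gcycle_def)
  have "\<exists>zs. 3 \<le> length zs \<and> distinct zs \<and> C = insert {last zs, hd zs} (pedges zs) \<and> {a, b} = {last zs, hd zs}"
  proof (cases "{a, b} \<in> pedges ys")
    case False
    then show ?thesis using ys assms(2) by blast
  next
    case True
    then obtain as bs where ab: "ys = as @ bs" "as \<noteq> []" "bs \<noteq> []" "{a, b} = {last as, hd bs}"
      using pedges_conv by blast
    then show ?thesis using ys
      by (intro exI[of _ "bs @ as"]) (auto simp: pedges_append insert_commute)
  qed
  then obtain zs where zs: "3 \<le> length zs" "distinct zs" "C = insert {last zs, hd zs} (pedges zs)"
    "{a, b} = {last zs, hd zs}" by blast
  have nin: "{a, b} \<notin> pedges zs" using closing_edge_notin_pedges zs by metis
  have ne: "zs \<noteq> []" using zs by auto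
  show ?thesis
  proof (cases "hd zs = a \<and> last zs = b")
    case True
    then show ?thesis using zs nin that by blast
  next
    case False
    then have "hd zs = b" "last zs = a" using zs(4) by (auto simp: doubleton_eq_iff)
    then show ?thesis using zs(1-3) nin by (intro that[of "rev zs"]) (simp_all add: pedges_rev hd_rev last_rev insert_commute)
  qed
qed

lemma gcycleI:
  "distinct xs \<Longrightarrow> 3 \<le> length xs \<Longrightarrow> gcycle (insert {hd xs, last xs} (pedges xs))"
  unfolding gcycle_def by (metis insert_commute)

lemma gcycle_doubleton: "gcycle C \<Longrightarrow> e \<in> C \<Longrightarrow> \<exists>a b. e = {a, b} \<and> a \<noteq> b"
proof -
  assume C: "gcycle C" and e: "e \<in> C"
  obtain ys where ys: "3 \<le> length ys" "distinct ys" "C = insert {last ys, hd ys} (pedges ys)"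
    using C by (auto simp: gcycle_def)
  have "last ys \<noteq> hd ys" using ys by (cases ys) auto
  moreover have "\<exists>a b. e = {a, b} \<and> a \<noteq> b" if "e \<in> pedges ys"
    using pedges_conv[OF that] ys(2)
    by (metis IntI distinct_append empty_iff last_in_set list.set_sel(1))
  ultimately show ?thesis using ys(3) e by blast
qed

lemma gcycle_finite: "gcycle C \<Longrightarrow> finite C"
  by (auto simp: gcycle_def)

lemma gcycle_card:
  assumes "distinct xs" "3 \<le> length xs"
  shows "card (insert {hd xs, last xs} (pedges xs)) = length xs"
proof -
  have "{hd xs, last xs} \<notin> pedges xs" using closing_edge_notin_pedges[OF assms] by (simp add: insert_commute)
  then show ?thesis using assms card_pedges[OF assms(1)] by simp
qed

lemma gcycle_nonempty: "gcycle C \<Longrightarrow> C \<noteq> {}"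
  by (auto simp: gcycle_def)

lemma gcycle_card_ge_3: "gcycle C \<Longrightarrow> 3 \<le> card C"
  unfolding gcycle_def by (metis gcycle_card insert_commute)

lemma gcycle_other_edge:
  assumes "gcycle C" "e \<in> C" "v \<in> e"
  shows "\<exists>e'\<in>C. e' \<noteq> e \<and> v \<in> e'"
proof -
  obtain a b where "e = {a, b}" using gcycle_doubleton assms by metis
  then obtain b where e: "e = {v, b}" using assms(3) by (metis insertE insert_commute singletonD)
  obtain xs where xs: "distinct xs" "3 \<le> length xs" "hd xs = v"
    "C = insert {v, b} (pedges xs)" "{v, b} \<notin> pedges xs"
    using gcycle_path_through[of C v b] assms e by metis
  then obtain y z zs where "xs = v # y # z # zs" by (cases xs rule: remdups_adj.cases) (auto simp: Suc_le_length_iff numeral_3_eq_3)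
  then have y: "{v, y} \<in> pedges xs" by simp
  have "{v, y} \<noteq> e" using y xs(5) unfolding e by metis
  moreover have "{v, y} \<in> C" using y xs(4) by simp
  ultimately show ?thesis by (intro bexI[of _ "{v, y}"]) simp_all
qed

lemma adjacency_sym: "(x, y) \<in> (adjacency S)\<^sup>* \<Longrightarrow> (y, x) \<in> (adjacency S)\<^sup>*"
proof -
  have "sym (adjacency S)" by (rule symI) (simp add: adjacency_def insert_commute)
  then show "(x, y) \<in> (adjacency S)\<^sup>* \<Longrightarrow> (y, x) \<in> (adjacency S)\<^sup>*"
    by (metis sym_rtrancl symD)
qed

lemma adjacency_mono: "S \<subseteq> S' \<Longrightarrow> (x, y) \<in> (adjacency S)\<^sup>* \<Longrightarrow> (x, y) \<in> (adjacency S')\<^sup>*"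
  by (rule rtrancl_mono[THEN subsetD]) (auto simp: adjacency_def)

lemma reachable_path:
  assumes "(u, v) \<in> (adjacency S)\<^sup>*"
  shows "\<exists>xs. xs \<noteq> [] \<and> distinct xs \<and> pedges xs \<subseteq> S \<and> hd xs = u \<and> last xs = v"
  using assms
proof (induction rule: converse_rtrancl_induct)
  case base
  show ?case by (intro exI[of _ "[v]"]) simp
next
  case (step y z)
  then obtain xs where xs: "xs \<noteq> []" "distinct xs" "pedges xs \<subseteq> S" "hd xs = z" "last xs = v" by blast
  show ?case
  proof (cases "y \<in> set xs")
    case True
    then obtain as bs where ab: "xs = as @ y # bs" by (meson split_list)
    have "pedges (y # bs) \<subseteq> S"
      using xs(3) ab by (cases "as = []") (auto simp: pedges_append)
    then show ?thesis using xs ab by (intro exI[of _ "y # bs"]) auto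
  next
    case False
    then show ?thesis using xs step(1)
      by (intro exI[of _ "y # xs"]) (cases xs, auto simp: adjacency_def)
  qed
qed

lemma reachable_closes_cycle:
  assumes "(u, v) \<in> (adjacency S)\<^sup>*" "u \<noteq> v" "{u, v} \<notin> S"
  obtains xs where "distinct xs" "3 \<le> length xs" "hd xs = u" "last xs = v" "pedges xs \<subseteq> S"
    "gcycle (insert {u, v} (pedges xs))"
proof -
  obtain xs where xs: "xs \<noteq> []" "distinct xs" "pedges xs \<subseteq> S" "hd xs = u" "last xs = v"
    using reachable_path[OF assms(1)] by blast
  have "3 \<le> length xs"
  proof (rule ccontr)
    assume "\<not> 3 \<le> length xs"
    then have "xs = [u] \<or> (\<exists>z. xs = [u, z])"
      using xs by (cases xs rule: remdups_adj.cases) (auto simp: not_le numeral_3_eq_3)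
    then show False
    proof
      assume "xs = [u]"
      then show False using xs assms(2) by simp
    next
      assume "\<exists>z. xs = [u, z]"
      then show False using xs(3,5) assms(3) by auto
    qed
  qed
  then show ?thesis using that gcycleI[of xs] xs by simp
qed

text \<open>\<open>R\<close> acts as a set of representatives of the components. It starts as
  \<open>V\<close>, and each new edge costs one representative: its ends have different ones,
  because a common one would connect them within \<open>S\<close> and the edge would close a
  cycle.\<close>

lemma acyclic_card_less:
  assumes "finite S" "finite V" "V \<noteq> {}"
    and "\<And>e. e \<in> S \<Longrightarrow> \<exists>u v. e = {u, v} \<and> u \<noteq> v \<and> u \<in> V \<and> v \<in> V"
    and "\<And>C. gcycle C \<Longrightarrow> \<not> C \<subseteq> S"
  shows "card S < card V"
proof -
  have "\<exists>R\<subseteq>V. card R + card S = card V \<and> (\<forall>v\<in>V. \<exists>r\<in>R. (v, r) \<in> (adjacency S)\<^sup>*)"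
    using assms(1,4,5)
  proof (induction S rule: finite_induct)
    case empty
    then show ?case by (intro exI[of _ V]) auto
  next
    case (insert e S)
    have "\<And>C. gcycle C \<Longrightarrow> \<not> C \<subseteq> S" using insert.prems(2) by blast
    then obtain R where R: "R \<subseteq> V" "card R + card S = card V"
      "\<forall>v\<in>V. \<exists>r\<in>R. (v, r) \<in> (adjacency S)\<^sup>*" using insert by (metis insertI2)
    obtain u v where uv: "e = {u, v}" "u \<noteq> v" "u \<in> V" "v \<in> V" using insert.prems(1) by blast
    obtain r1 r2 where r: "r1 \<in> R" "r2 \<in> R" "(u, r1) \<in> (adjacency S)\<^sup>*" "(v, r2) \<in> (adjacency S)\<^sup>*"
      using R uv by meson
    have "r1 \<noteq> r2"
    proof
      assume "r1 = r2"
      then have "(u, v) \<in> (adjacency S)\<^sup>*" using r by (meson adjacency_sym rtrancl_trans)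
      then obtain xs where "pedges xs \<subseteq> S" "gcycle (insert {u, v} (pedges xs))"
        using reachable_closes_cycle[of u v S] insert.hyps uv by metis
      then show False using insert.prems(2) uv by (metis insert_mono)
    qed
    let ?A = "(adjacency (insert e S))\<^sup>*"
    have sub: "(adjacency S)\<^sup>* \<subseteq> ?A" using adjacency_mono[of S "insert e S"] by auto
    have "(v, u) \<in> ?A" using uv(1) by (intro r_into_rtrancl) (simp add: adjacency_def insert_commute)
    then have "(r2, r1) \<in> ?A" using subsetD[OF sub r(3)] subsetD[OF sub adjacency_sym[OF r(4)]] by (meson rtrancl_trans)
    have "\<exists>r\<in>R - {r2}. (w, r) \<in> ?A" if w: "w \<in> V" for w
    proof -
      obtain r where r': "r \<in> R" "(w, r) \<in> ?A" using R(3) w sub by blast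
      show ?thesis
      proof (cases "r = r2")
        case True
        then have "(w, r1) \<in> ?A" using r'(2) \<open>(r2, r1) \<in> ?A\<close> by (meson rtrancl_trans)
        then show ?thesis using r(1) \<open>r1 \<noteq> r2\<close> by blast
      qed (use r' in blast)
    qed
    moreover have "card (R - {r2}) + card (insert e S) = card V"
    proof -
      have "finite R" using R(1) assms(2) finite_subset by metis
      have "card R = Suc (card (R - {r2}))" using \<open>finite R\<close> r(2) by (rule card.remove)
      then show ?thesis using insert.hyps R(2) by simp
    qed
    ultimately show ?case using R(1) by (intro exI[of _ "R - {r2}"]) blast
  qed
  then obtain R where "R \<subseteq> V" "card R + card S = card V" "\<forall>v\<in>V. \<exists>r\<in>R. (v, r) \<in> (adjacency S)\<^sup>*" by blast
  moreover have "R \<noteq> {}" using calculation assms(3) by blast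
  then have "card R > 0" using calculation(1) assms(2) by (meson card_gt_0_iff finite_subset)
  ultimately show ?thesis by simp
qed

section \<open>Plane drawings\<close>

text \<open>Faces and cycles see only the image of an edge, so curves are replaced by point sets
  \<open>I e\<close>. Since \<open>{u, v}\<close> is unordered, \<open>edge_arc\<close> supplies an
  arc in either direction.\<close>

locale plane_graph =
  fixes V :: "'a set" and E :: "'a set set" and \<phi> :: "'a \<Rightarrow> complex" and I :: "'a set \<Rightarrow> complex set"
  assumes finite_V: "finite V"
    and edgeD: "e \<in> E \<Longrightarrow> \<exists>u v. e = {u, v} \<and> u \<noteq> v \<and> u \<in> V \<and> v \<in> V"
    and inj_verts: "inj_on \<phi> V"
    and edge_arc: "{u, v} \<in> E \<Longrightarrow>
      \<exists>g. arc g \<and> pathstart g = \<phi> u \<and> pathfinish g = \<phi> v \<and> path_image g = I {u, v}"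
    and edge_avoids_verts: "e \<in> E \<Longrightarrow> w \<in> V \<Longrightarrow> \<phi> w \<in> I e \<Longrightarrow> w \<in> e"
    and edges_cross: "e \<in> E \<Longrightarrow> e' \<in> E \<Longrightarrow> e \<noteq> e' \<Longrightarrow> I e \<inter> I e' \<subseteq> \<phi> ` (e \<inter> e')"
begin

definition drawn :: "'a set set \<Rightarrow> complex set" where "drawn S = (\<Union>e\<in>S. I e)"
text \<open>All of \<open>V\<close> is drawn, whatever \<open>S\<close> is. Hence a point of an edge
  that avoids \<open>drawing S\<close> is never a vertex.\<close>

definition drawing :: "'a set set \<Rightarrow> complex set" where "drawing S = \<phi> ` V \<union> drawn S"
definition interior_of_edge :: "'a set \<Rightarrow> complex set" where "interior_of_edge e = I e - \<phi> ` e"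

lemma finite_E: "finite E"
  by (rule finite_subset[of _ "Pow V"]) (use edgeD finite_V in auto)

lemma edge_subset_V: "e \<in> E \<Longrightarrow> e \<subseteq> V"
  using edgeD by blast

lemma edge_compact: "e \<in> E \<Longrightarrow> compact (I e)"
  using edgeD edge_arc compact_arc_image by metis

lemma edge_ends: "e \<in> E \<Longrightarrow> \<phi> ` e \<subseteq> I e"
proof -
  assume e: "e \<in> E"
  obtain u v where uv: "e = {u, v}" using edgeD[OF e] by blast
  obtain g where "pathstart g = \<phi> u" "pathfinish g = \<phi> v" "path_image g = I e"
    using edge_arc[of u v] e uv by auto
  then show ?thesis using uv pathstart_in_path_image[of g] pathfinish_in_path_image[of g] by auto
qed

lemma compact_drawn: "S \<subseteq> E \<Longrightarrow> compact (drawn S)"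
  unfolding drawn_def using finite_subset[OF _ finite_E] edge_compact by (intro compact_UN) auto

lemma compact_drawing: "S \<subseteq> E \<Longrightarrow> compact (drawing S)"
  unfolding drawing_def using compact_drawn finite_V by (simp add: compact_Un finite_imp_compact)

lemma interior_of_edge_disjoint_drawn:
  "e \<in> E \<Longrightarrow> S \<subseteq> E \<Longrightarrow> e \<notin> S \<Longrightarrow> interior_of_edge e \<inter> drawn S = {}"
  unfolding drawn_def interior_of_edge_def using edges_cross by blast

lemma interior_of_edge_disjoint:
  "e \<in> E \<Longrightarrow> S \<subseteq> E \<Longrightarrow> e \<notin> S \<Longrightarrow> interior_of_edge e \<inter> drawing S = {}"
  using interior_of_edge_disjoint_drawn[of e S] edge_avoids_verts[of e]
  unfolding drawing_def interior_of_edge_def by blast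

lemma interior_of_edge_connected:
  assumes "e \<in> E"
  shows "connected (interior_of_edge e)" "interior_of_edge e \<noteq> {}"
proof -
  obtain u v where uv: "e = {u, v}" using edgeD[OF assms] by blast
  obtain g where g: "arc g" "pathstart g = \<phi> u" "pathfinish g = \<phi> v" "path_image g = I e"
    using edge_arc[of u v] assms uv by auto
  have "interior_of_edge e = path_image g - {pathstart g, pathfinish g}"
    using g uv by (simp add: interior_of_edge_def)
  then show "connected (interior_of_edge e)" "interior_of_edge e \<noteq> {}"
    using g(1) connected_simple_path_endless nonempty_simple_path_endless arc_imp_simple_path by metis+
qed

lemma path_drawn:
  assumes "distinct xs" "2 \<le> length xs" "pedges xs \<subseteq> E"
  shows "\<exists>g. arc g \<and> pathstart g = \<phi> (hd xs) \<and> pathfinish g = \<phi> (last xs) \<and> path_image g = drawn (pedges xs)"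
  using assms
proof (induction xs rule: pedges.induct)
  case (1 x y zs)
  obtain g where g: "arc g" "pathstart g = \<phi> x" "pathfinish g = \<phi> y" "path_image g = I {x, y}"
    using edge_arc[of x y] 1 by auto
  show ?case
  proof (cases "zs = []")
    case True
    then show ?thesis using g by (auto simp: drawn_def)
  next
    case False
    then obtain h where h: "arc h" "pathstart h = \<phi> y" "pathfinish h = \<phi> (last zs)"
      "path_image h = drawn (pedges (y # zs))"
      using 1 by (auto simp: Suc_le_eq)
    have "I {x, y} \<inter> I e \<subseteq> {\<phi> y}" if e: "e \<in> pedges (y # zs)" for e
    proof -
      have "x \<notin> e" using pedges_subset_set[OF e] 1(2) by auto
      then have "I {x, y} \<inter> I e \<subseteq> \<phi> ` ({x, y} \<inter> e)"
        using 1(4) e by (intro edges_cross) auto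
      then show ?thesis using \<open>x \<notin> e\<close> by auto
    qed
    then have "path_image g \<inter> path_image h \<subseteq> {pathstart h}"
      unfolding g h drawn_def by blast
    then have "arc (g +++ h)" using g h by (intro arc_join) auto
    moreover have "path_image (g +++ h) = drawn (pedges (x # y # zs))"
      using g h by (simp add: path_image_join drawn_def)
    ultimately show ?thesis using g h False by (intro exI[of _ "g +++ h"]) simp
  qed
qed auto

text \<open>Without one open edge, the cycle is the arc drawn by the remaining path. This is the
  connected intersection to which Janiszewski's theorem is applied later.\<close>

lemma cycle_drawn:
  assumes C: "gcycle C" "C \<subseteq> E" and e: "e \<in> C"
  shows "\<exists>g. simple_path g \<and> pathfinish g = pathstart g \<and> path_image g = drawn C"
    and "connected (drawn C - interior_of_edge e)"
proof -
  have eE: "e \<in> E" using C e by blast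
  obtain a b where ab: "e = {a, b}" "a \<noteq> b" using gcycle_doubleton C e by metis
  obtain xs where xs: "distinct xs" "3 \<le> length xs" "hd xs = a" "last xs = b"
    "C = insert e (pedges xs)" "e \<notin> pedges xs"
    using gcycle_path_through[of C a b] C e ab by metis
  have sub: "pedges xs \<subseteq> E" using xs C by auto
  obtain g where g: "arc g" "pathstart g = \<phi> a" "pathfinish g = \<phi> b" "path_image g = drawn (pedges xs)"
    using path_drawn[of xs] xs(1-4) sub by auto
  obtain h where h: "arc h" "pathstart h = \<phi> b" "pathfinish h = \<phi> a" "path_image h = I e"
    using edge_arc[of b a] eE ab by (auto simp: insert_commute)
  have "interior_of_edge e \<inter> drawn (pedges xs) = {}"
    using interior_of_edge_disjoint_drawn eE sub xs(6) by simp
  then have int: "I e \<inter> drawn (pedges xs) \<subseteq> {\<phi> a, \<phi> b}"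
    using ab unfolding interior_of_edge_def by auto
  have "simple_path (g +++ h)"
    using g h int by (intro simple_path_join_loop) auto
  moreover have "path_image (g +++ h) = drawn C"
    using g h xs(5) by (auto simp: path_image_join drawn_def)
  ultimately show "\<exists>g. simple_path g \<and> pathfinish g = pathstart g \<and> path_image g = drawn C"
    using g h by (intro exI[of _ "g +++ h"]) simp
  have "\<phi> a \<in> drawn (pedges xs)" "\<phi> b \<in> drawn (pedges xs)"
    using g pathstart_in_path_image[of g] pathfinish_in_path_image[of g] by auto
  then have "drawn C - interior_of_edge e = drawn (pedges xs)"
    using \<open>interior_of_edge e \<inter> drawn (pedges xs) = {}\<close> xs(5) ab
    unfolding drawn_def interior_of_edge_def by auto
  then show "connected (drawn C - interior_of_edge e)"
    using g connected_arc_image by metis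
qed

lemma cycle_sides:
  assumes C: "gcycle C" "C \<subseteq> E"
  shows "connected (inside (drawn C))" "connected (outside (drawn C))"
    "open (inside (drawn C))" "open (outside (drawn C))"
    "frontier (inside (drawn C)) = drawn C" "frontier (outside (drawn C)) = drawn C"
    "inside (drawn C) \<union> outside (drawn C) = - drawn C"
proof -
  obtain e where "e \<in> C" using gcycle_nonempty[OF C(1)] by blast
  then obtain g where g: "simple_path g" "pathfinish g = pathstart g" "path_image g = drawn C"
    using cycle_drawn C by metis
  show "connected (inside (drawn C))" "connected (outside (drawn C))"
    "open (inside (drawn C))" "open (outside (drawn C))"
    "frontier (inside (drawn C)) = drawn C" "frontier (outside (drawn C)) = drawn C"
    "inside (drawn C) \<union> outside (drawn C) = - drawn C"
    using Jordan_inside_outside[OF g(1,2)] unfolding g(3) by blast+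
qed

lemma same_side_iff:
  assumes C: "gcycle C" "C \<subseteq> E" and ab: "a \<notin> drawn C" "b \<notin> drawn C"
  shows "connected_component (- drawn C) a b \<longleftrightarrow> (a \<in> inside (drawn C) \<longleftrightarrow> b \<in> inside (drawn C))"
proof
  assume "connected_component (- drawn C) a b"
  then show "a \<in> inside (drawn C) \<longleftrightarrow> b \<in> inside (drawn C)"
    using inside_same_component connected_component_sym by metis
next
  assume eq: "a \<in> inside (drawn C) \<longleftrightarrow> b \<in> inside (drawn C)"
  have sub: "inside (drawn C) \<subseteq> - drawn C" "outside (drawn C) \<subseteq> - drawn C"
    using cycle_sides(7)[OF C] by blast+
  have *: "connected_component (- drawn C) a b" if "connected X" "a \<in> X" "b \<in> X" "X \<subseteq> - drawn C" for X
    using that by (auto simp: connected_component_def)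
  show "connected_component (- drawn C) a b"
  proof (cases "a \<in> inside (drawn C)")
    case True
    then show ?thesis using eq cycle_sides(1)[OF C] sub by (intro *[of "inside (drawn C)"]) simp_all
  next
    case False
    then have "a \<in> outside (drawn C)" "b \<in> outside (drawn C)" using eq cycle_sides(7)[OF C] ab by blast+
    then show ?thesis using cycle_sides(2)[OF C] sub by (intro *[of "outside (drawn C)"]) simp_all
  qed
qed

section \<open>Separation of points by cycles of the drawing\<close>

lemma drawing_mono: "S \<subseteq> S' \<Longrightarrow> drawing S \<subseteq> drawing S'"
  by (auto simp: drawing_def drawn_def)

lemma drawn_mono: "S \<subseteq> S' \<Longrightarrow> drawn S \<subseteq> drawn S'"
  by (auto simp: drawn_def)

lemma connected_component_complement_mono:
  "connected_component (- X) a b \<Longrightarrow> Y \<subseteq> X \<Longrightarrow> connected_component (- Y) a b"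
  unfolding connected_component_def by blast

lemma connected_complement_finite:
  fixes X :: "complex set"
  assumes "finite X" shows "connected (- X)"
  using connected_open_diff_countable[of UNIV X] assms
  by (simp add: Compl_eq_Diff_UNIV countable_finite convex_connected)

text \<open>Edges are inserted one at a time. If the new edge closes a cycle, this cycle meets the
  old drawing exactly in the cycle without the open edge; that set is connected, so Janiszewski's
  theorem applies. Otherwise the old drawing meets the new edge in its two ends, which is not a
  connected set, and the old drawing has to be split first.\<close>

lemma separated_by_cycle:
  assumes "S \<subseteq> E" "a \<notin> drawing S" "b \<notin> drawing S"
    and "\<And>C. gcycle C \<Longrightarrow> C \<subseteq> S \<Longrightarrow> connected_component (- drawn C) a b"
  shows "connected_component (- drawing S) a b"
proof -
  have "finite S" using assms(1) finite_E finite_subset by blast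
  then show ?thesis using assms
  proof (induction S rule: finite_induct)
    case empty
    have "connected (- drawing {})"
      using finite_V by (intro connected_complement_finite) (simp add: drawing_def drawn_def)
    then show ?case using empty unfolding connected_component_def by blast
  next
    case (insert e S)
    have eE: "e \<in> E" and SE: "S \<subseteq> E" using insert.prems(1) by auto
    have dr: "drawing (insert e S) = drawing S \<union> I e"
      by (auto simp: drawing_def drawn_def)
    have IH: "connected_component (- drawing S) a b"
      using insert.prems by (intro insert.IH) (auto simp: dr)
    obtain u v where uv: "e = {u, v}" "u \<noteq> v" "u \<in> V" "v \<in> V" using edgeD[OF eE] by blast
    have uvD: "\<phi> u \<in> drawing S" "\<phi> v \<in> drawing S" using uv by (auto simp: drawing_def)
    have uvI: "\<phi> u \<in> I e" "\<phi> v \<in> I e" using edge_ends[OF eE] uv by auto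
    have int: "drawing S \<inter> I e \<subseteq> {\<phi> u, \<phi> v}"
      using interior_of_edge_disjoint[OF eE SE] insert.hyps uv unfolding interior_of_edge_def by auto
    show ?case
    proof (cases "(u, v) \<in> (adjacency S)\<^sup>*")
      case True
      then obtain xs where xs: "pedges xs \<subseteq> S" "gcycle (insert e (pedges xs))"
        using reachable_closes_cycle[of u v S] insert.hyps uv by metis
      let ?C = "insert e (pedges xs)"
      have CE: "?C \<subseteq> E" "?C \<subseteq> insert e S" using xs eE SE by auto
      have eq: "drawing S \<inter> drawn ?C = drawn ?C - interior_of_edge e"
      proof -
        have "interior_of_edge e \<inter> drawing S = {}" using interior_of_edge_disjoint[OF eE SE] insert.hyps by simp
        moreover have "I e \<subseteq> interior_of_edge e \<union> drawing S"
          using uvD uv by (auto simp: interior_of_edge_def)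
        moreover have "drawn (pedges xs) \<subseteq> drawing S"
          using drawn_mono[OF xs(1)] by (auto simp: drawing_def)
        ultimately show ?thesis by (auto simp: drawn_def)
      qed
      have "connected_component (- (drawing S \<union> drawn ?C)) a b"
      proof (rule Janiszewski)
        show "compact (drawing S)" by (rule compact_drawing[OF SE])
        show "closed (drawn ?C)" using compact_drawn[OF CE(1)] by (rule compact_imp_closed)
        show "connected (drawing S \<inter> drawn ?C)"
          unfolding eq using cycle_drawn(2)[OF xs(2) CE(1)] by simp
        show "connected_component (- drawn ?C) a b"
          using insert.prems(4)[OF xs(2) CE(2)] .
      qed (rule IH)
      then show ?thesis
        by (rule connected_component_complement_mono) (auto simp: dr drawn_def)
    next
      case False
      \<comment> \<open>Adding \<open>e\<close> first to the part reachable from \<open>u\<close> and then to the rest, each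
        intersection is a single point.\<close>
      define R where "R = {w. (u, w) \<in> (adjacency S)\<^sup>*}"
      define S1 where "S1 = {f \<in> S. f \<subseteq> R}"
      define S2 where "S2 = {f \<in> S. f \<inter> R = {}}"
      have split: "f \<subseteq> R \<or> f \<inter> R = {}" if f: "f \<in> S" for f
      proof -
        obtain x y where xy: "f = {x, y}" using edgeD f SE by blast
        have "(x, y) \<in> adjacency S" "(y, x) \<in> adjacency S"
          using f xy by (auto simp: adjacency_def insert_commute)
        then have "x \<in> R \<longleftrightarrow> y \<in> R" unfolding R_def by (auto intro: rtrancl_into_rtrancl)
        then show ?thesis using xy by auto
      qed
      then have SS: "S = S1 \<union> S2" by (auto simp: S1_def S2_def)
      define D1 where "D1 = \<phi> ` (V \<inter> R) \<union> drawn S1"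
      define D2 where "D2 = \<phi> ` (V - R) \<union> drawn S2"
      have DD: "drawing S = D1 \<union> D2" unfolding drawing_def D1_def D2_def SS drawn_def by auto
      have uR: "u \<in> R" and vR: "v \<notin> R" using False by (auto simp: R_def)
      have S12: "S1 \<subseteq> E" "S2 \<subseteq> E" using SE by (auto simp: S1_def S2_def)
      have v1: "\<phi> v \<notin> D1"
      proof
        assume "\<phi> v \<in> D1"
        moreover have "\<phi> v \<notin> \<phi> ` (V \<inter> R)"
          using inj_verts uv(4) vR by (auto dest: inj_onD)
        ultimately obtain f where "f \<in> S1" "\<phi> v \<in> I f" unfolding D1_def drawn_def by blast
        then have "v \<in> f" using edge_avoids_verts S12 uv by blast
        then show False using \<open>f \<in> S1\<close> vR by (auto simp: S1_def)
      qed
      have u2: "\<phi> u \<notin> D2"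
      proof
        assume "\<phi> u \<in> D2"
        moreover have "\<phi> u \<notin> \<phi> ` (V - R)"
          using inj_verts uv(3) uR by (auto dest: inj_onD)
        ultimately obtain f where "f \<in> S2" "\<phi> u \<in> I f" unfolding D2_def drawn_def by blast
        then have "u \<in> f" using edge_avoids_verts S12 uv by blast
        then show False using \<open>f \<in> S2\<close> uR by (auto simp: S2_def)
      qed
      have D12: "D1 \<inter> D2 = {}"
      proof -
        have "\<phi> ` (V \<inter> R) \<inter> \<phi> ` (V - R) = {}" using inj_verts by (auto dest: inj_onD)
        moreover have "\<phi> ` (V \<inter> R) \<inter> drawn S2 = {}"
          using edge_avoids_verts S12 unfolding drawn_def S2_def by blast
        moreover have "\<phi> ` (V - R) \<inter> drawn S1 = {}"
          using edge_avoids_verts S12 unfolding drawn_def S1_def by blast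
        moreover have "I f \<inter> I f' = {}" if "f \<in> S1" "f' \<in> S2" for f f'
        proof -
          have fE: "f \<in> E" "f' \<in> E" using that S12 by auto
          have "f \<inter> f' = {}" using that by (auto simp: S1_def S2_def)
          moreover have "f \<noteq> f'" using edgeD[OF fE(1)] calculation by auto
          ultimately show ?thesis using edges_cross[OF fE] by auto
        qed
        then have "drawn S1 \<inter> drawn S2 = {}" unfolding drawn_def by blast
        ultimately show ?thesis unfolding D1_def D2_def by blast
      qed
      have comp: "compact D1" "compact D2"
        unfolding D1_def D2_def using compact_drawn S12 finite_V
        by (simp_all add: compact_Un finite_imp_compact)
      have eq1: "D1 \<inter> I e = {\<phi> u}" and eq2: "D2 \<inter> (D1 \<union> I e) = {\<phi> v}"
        using int uvD uvI v1 u2 D12 unfolding DD by blast+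
      have ce: "connected_component (- I e) a b"
      proof -
        obtain g where "arc g" "path_image g = I e" using edge_arc[of u v] eE uv by auto
        then have "connected (- I e)" using connected_arc_complement[of g] by simp
        then show ?thesis using insert.prems(2,3) unfolding dr connected_component_def by blast
      qed
      have c1: "connected_component (- (D1 \<union> I e)) a b"
      proof (rule Janiszewski)
        show "closed (I e)" using edge_compact[OF eE] by (rule compact_imp_closed)
        show "connected_component (- D1) a b"
          using IH by (rule connected_component_complement_mono) (simp add: DD)
      qed (use comp ce eq1 in auto)
      have "connected_component (- (D2 \<union> (D1 \<union> I e))) a b"
      proof (rule Janiszewski)
        show "closed (D1 \<union> I e)" using edge_compact[OF eE] comp by (simp add: compact_imp_closed closed_Un)
        show "connected_component (- D2) a b"
          using IH by (rule connected_component_complement_mono) (simp add: DD)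
      qed (use comp c1 eq2 in auto)
      then show ?thesis unfolding dr DD by (simp add: Un_ac)
    qed
  qed
qed

end

section \<open>Faces\<close>

lemma connected_Un_closure:
  assumes "connected S" "connected T" "T \<inter> closure S \<noteq> {}"
  shows "connected (S \<union> T)"
proof -
  obtain x where x: "x \<in> T" "x \<in> closure S" using assms by blast
  have "connected (insert x S)"
    using assms(1) by (rule connected_intermediate_closure) (use x closure_subset in auto)
  then have "connected (insert x S \<union> T)"
    using assms(2) x by (intro connected_Un) auto
  moreover have "insert x S \<union> T = S \<union> T" using x by auto
  ultimately show ?thesis by simp
qed

lemma closure_Union_finite: "finite A \<Longrightarrow> closure (\<Union>A) = (\<Union>S\<in>A. closure S)"
  by (induction A rule: finite_induct) auto

context plane_graph
begin

definition faces :: "complex set set" where "faces = components (- drawing E)"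

text \<open>
  Edges lying on no cycle are left out, so that every edge is on the boundary of exactly two
  faces or of none.
\<close>

definition face_boundary :: "complex set \<Rightarrow> 'a set set" where
  "face_boundary f = {e \<in> E. (\<exists>C. gcycle C \<and> C \<subseteq> E \<and> e \<in> C) \<and> interior_of_edge e \<inter> closure f \<noteq> {}}"

definition in_inside :: "'a set set \<Rightarrow> complex set \<Rightarrow> bool" where
  "in_inside C f \<longleftrightarrow> f \<subseteq> inside (drawn C)"

lemma open_complement_drawing: "open (- drawing E)"
  using compact_drawing[of E] by (simp add: compact_imp_closed open_Compl)

lemma face_open: "f \<in> faces \<Longrightarrow> open f"
  unfolding faces_def using open_complement_drawing open_components by blast

lemma face_connected: "f \<in> faces \<Longrightarrow> connected f"
  unfolding faces_def by (rule in_components_connected)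

lemma face_nonempty: "f \<in> faces \<Longrightarrow> f \<noteq> {}"
  unfolding faces_def by (rule in_components_nonempty)

lemma face_subset: "f \<in> faces \<Longrightarrow> f \<subseteq> - drawing E"
  unfolding faces_def by (rule in_components_subset)

lemma faces_eqI: "f \<in> faces \<Longrightarrow> g \<in> faces \<Longrightarrow> x \<in> f \<Longrightarrow> x \<in> g \<Longrightarrow> f = g"
  unfolding faces_def using components_eq by blast

lemma faces_eqI_connected:
  "f \<in> faces \<Longrightarrow> g \<in> faces \<Longrightarrow> a \<in> f \<Longrightarrow> b \<in> g \<Longrightarrow> connected_component (- drawing E) a b \<Longrightarrow> f = g"
  unfolding faces_def by (auto simp: components_iff connected_component_eq_eq)
    (metis connected_component_eq mem_Collect_eq)+

lemma in_some_face: "x \<notin> drawing E \<Longrightarrow> \<exists>f\<in>faces. x \<in> f"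
  unfolding faces_def using Union_components[of "- drawing E"] by blast

lemma closure_face: "f \<in> faces \<Longrightarrow> x \<in> closure f \<Longrightarrow> x \<notin> f \<Longrightarrow> x \<in> drawing E"
proof (rule ccontr)
  assume f: "f \<in> faces" "x \<in> closure f" "x \<notin> f" and "x \<notin> drawing E"
  then obtain g where g: "g \<in> faces" "x \<in> g" using in_some_face by blast
  then have "g \<inter> f \<noteq> {}" using f(2) face_open[OF g(1)] open_Int_closure_eq_empty[of g f] by blast
  then show False using faces_eqI f g by blast
qed

lemma drawn_subset_drawing: "S \<subseteq> E \<Longrightarrow> drawn S \<subseteq> drawing E"
  by (auto simp: drawing_def drawn_def)

lemma in_inside_iff:
  assumes "gcycle C" "C \<subseteq> E" "f \<in> faces" "a \<in> f"
  shows "in_inside C f \<longleftrightarrow> a \<in> inside (drawn C)"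
proof
  assume a: "a \<in> inside (drawn C)"
  show "in_inside C f"
    unfolding in_inside_def
  proof
    fix b assume b: "b \<in> f"
    have ab: "f \<subseteq> - drawn C" using face_subset[OF assms(3)] drawn_subset_drawing[OF assms(2)] by blast
    then have "connected_component (- drawn C) a b"
      using face_connected[OF assms(3)] assms(4) b unfolding connected_component_def by blast
    then show "b \<in> inside (drawn C)" using same_side_iff[OF assms(1,2), of a b] a ab b assms(4) by blast
  qed
qed (use assms in \<open>auto simp: in_inside_def\<close>)

lemma face_avoids_drawn: "f \<in> faces \<Longrightarrow> S \<subseteq> E \<Longrightarrow> f \<subseteq> - drawn S"
  using face_subset drawn_subset_drawing by blast

lemma faces_same_side:
  assumes "gcycle C" "C \<subseteq> E" "f \<in> faces" "g \<in> faces" "a \<in> f" "b \<in> g"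
  shows "connected_component (- drawn C) a b \<longleftrightarrow> in_inside C f = in_inside C g"
proof -
  have "a \<notin> drawn C" "b \<notin> drawn C" using face_avoids_drawn assms by blast+
  then show ?thesis
    using same_side_iff[OF assms(1,2), of a b] in_inside_iff[OF assms(1,2,3,5)] in_inside_iff[OF assms(1,2,4,6)]
    by simp
qed

text \<open>A face is determined by the set of cycles that enclose it, since two faces on the same
  side of every cycle coincide; and \<open>E\<close> has only finitely many sets of subsets.\<close>

lemma finite_faces: "finite faces"
proof (rule inj_on_finite)
  let ?m = "\<lambda>f. {C. gcycle C \<and> C \<subseteq> E \<and> in_inside C f}"
  show "finite (Pow (Pow E))" using finite_E by simp
  show "?m ` faces \<subseteq> Pow (Pow E)" by auto
  show "inj_on ?m faces"
  proof (rule inj_onI)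
    fix f g assume fg: "f \<in> faces" "g \<in> faces" and eq: "?m f = ?m g"
    obtain a b where ab: "a \<in> f" "b \<in> g" using face_nonempty fg by blast
    have "connected_component (- drawing E) a b"
    proof (rule separated_by_cycle)
      show "a \<notin> drawing E" "b \<notin> drawing E" using face_subset fg ab by auto
      fix C assume C: "gcycle C" "C \<subseteq> E"
      have "in_inside C f \<longleftrightarrow> in_inside C g" using eq C by blast
      then show "connected_component (- drawn C) a b"
        using faces_same_side[OF C fg ab] by simp
    qed simp
    then show "f = g" using faces_eqI_connected fg ab by blast
  qed
qed

text \<open>Let \<open>B\<close> be the set of edges touching the closure of \<open>f\<close>. If no
  cycle in \<open>B\<close> separated the faces, a connected set avoiding \<open>drawing B\<close>
  would lead from \<open>f\<close> to \<open>g\<close>. It would leave \<open>f\<close> at a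
  frontier point, which lies inside an edge touching \<open>f\<close>, hence in
  \<open>drawing B\<close>. That the cycle is confined to the boundary of \<open>f\<close> is what
  later controls the lengths of faces.\<close>

lemma faces_separated:
  assumes "f \<in> faces" "g \<in> faces" "f \<noteq> g"
  shows "\<exists>C. gcycle C \<and> C \<subseteq> face_boundary f \<and> in_inside C f \<noteq> in_inside C g"
proof (rule ccontr)
  assume no: "\<not> ?thesis"
  define B where "B = {e \<in> E. interior_of_edge e \<inter> closure f \<noteq> {}}"
  have BE: "B \<subseteq> E" by (auto simp: B_def)
  obtain a b where ab: "a \<in> f" "b \<in> g" using face_nonempty assms by blast
  have nin: "a \<notin> drawing E" "b \<notin> drawing E" using face_subset assms ab by auto
  have "connected_component (- drawing B) a b"
  proof (rule separated_by_cycle[OF BE])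
    show "a \<notin> drawing B" "b \<notin> drawing B" using nin drawing_mono[OF BE] by auto
    fix C assume C: "gcycle C" "C \<subseteq> B"
    have CE: "C \<subseteq> E" using C BE by blast
    have "C \<subseteq> face_boundary f" using C CE unfolding face_boundary_def B_def by blast
    then have "in_inside C f = in_inside C g" using no C by blast
    then show "connected_component (- drawn C) a b"
      using faces_same_side[OF C(1) CE assms(1,2) ab] by simp
  qed
  then obtain X where X: "connected X" "X \<subseteq> - drawing B" "a \<in> X" "b \<in> X"
    unfolding connected_component_def by blast
  have "b \<notin> f" using faces_eqI assms ab by blast
  then have "X \<inter> frontier f \<noteq> {}" using X ab by (intro connected_Int_frontier) auto
  then obtain x where x: "x \<in> X" "x \<in> closure f" "x \<notin> f"
    using face_open[OF assms(1)] by (auto simp: frontier_def interior_open)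
  then have "x \<in> drawing E" using closure_face assms by blast
  moreover have "x \<notin> drawing B" using x X by blast
  ultimately obtain e where e: "e \<in> E" "x \<in> I e" "x \<notin> \<phi> ` V" by (auto simp: drawing_def drawn_def)
  then have "x \<in> interior_of_edge e" using edge_subset_V by (auto simp: interior_of_edge_def)
  then have "e \<in> B" using e x by (auto simp: B_def)
  then show False using e \<open>x \<notin> drawing B\<close> by (auto simp: drawing_def drawn_def)
qed

section \<open>Faces on the two sides of an edge\<close>

lemma face_boundary_subset: "face_boundary f \<subseteq> E"
  by (auto simp: face_boundary_def)

text \<open>If \<open>e\<close> is not on \<open>C\<close>, the two faces and the open edge form a
  connected set off \<open>C\<close>. If \<open>e\<close> is on \<open>C\<close> but
  \<open>C\<close> does not separate the faces, then neither does the drawing without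
  \<open>e\<close>. These two sets meet in \<open>C\<close> without the open edge, so by
  Janiszewski's theorem the full drawing would not separate two different faces.\<close>

lemma crossing_iff:
  assumes fg: "f \<in> faces" "g \<in> faces" "f \<noteq> g" and e: "e \<in> face_boundary f" "e \<in> face_boundary g"
    and C: "gcycle C" "C \<subseteq> E"
  shows "in_inside C f \<noteq> in_inside C g \<longleftrightarrow> e \<in> C"
proof -
  have eE: "e \<in> E" using e face_boundary_subset by blast
  obtain a b where ab: "a \<in> f" "b \<in> g" using face_nonempty fg by blast
  define X where "X = (g \<union> (f \<union> interior_of_edge e))"
  have "connected X"
    unfolding X_def using face_connected fg interior_of_edge_connected(1)[OF eE] e
    by (intro connected_Un_closure) (auto simp: face_boundary_def)
  have sep: "connected_component (- drawn C) a b \<longleftrightarrow> (in_inside C f \<longleftrightarrow> in_inside C g)"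
    by (rule faces_same_side[OF C fg(1,2) ab])
  show ?thesis
  proof
    assume ne: "in_inside C f \<noteq> in_inside C g"
    show "e \<in> C"
    proof (rule ccontr)
      assume "e \<notin> C"
      then have "X \<subseteq> - drawn C"
        using interior_of_edge_disjoint_drawn[OF eE C(2)] face_avoids_drawn[OF _ C(2)] fg
        unfolding X_def by blast
      then have "connected_component (- drawn C) a b"
        using \<open>connected X\<close> ab unfolding connected_component_def X_def by blast
      then show False using ne sep by blast
    qed
  next
    assume eC: "e \<in> C"
    show "in_inside C f \<noteq> in_inside C g"
    proof
      assume "in_inside C f = in_inside C g"
      then have ccC: "connected_component (- drawn C) a b" using sep by blast
      let ?D = "drawing (E - {e})"
      have "X \<subseteq> - ?D"
        using interior_of_edge_disjoint[OF eE, of "E - {e}"] face_subset fg drawing_mono[of "E - {e}" E]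
        unfolding X_def by blast
      then have ccD: "connected_component (- ?D) a b"
        using \<open>connected X\<close> ab unfolding connected_component_def X_def by blast
      have eq: "?D \<inter> drawn C = drawn C - interior_of_edge e"
      proof -
        have "interior_of_edge e \<inter> ?D = {}" using interior_of_edge_disjoint[OF eE, of "E - {e}"] by auto
        moreover have "I e \<subseteq> interior_of_edge e \<union> \<phi> ` V"
          using edge_subset_V[OF eE] by (auto simp: interior_of_edge_def)
        ultimately show ?thesis using C(2) by (auto simp: drawn_def drawing_def)
      qed
      have "connected_component (- (?D \<union> drawn C)) a b"
      proof (rule Janiszewski)
        show "compact ?D" by (rule compact_drawing) auto
        show "closed (drawn C)" using compact_drawn[OF C(2)] by (rule compact_imp_closed)
        show "connected (?D \<inter> drawn C)" unfolding eq using cycle_drawn(2)[OF C eC] .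
      qed (use ccC ccD in auto)
      moreover have "?D \<union> drawn C = drawing E"
        using eC C(2) by (auto simp: drawing_def drawn_def)
      ultimately show False using faces_eqI_connected fg ab by metis
    qed
  qed
qed

text \<open>The point \<open>x\<close> lies on the frontier of both sides of \<open>C\<close>. Near
  \<open>x\<close> only \<open>e\<close> is drawn, so the nearby part of \<open>X\<close> is covered
  by faces within \<open>X\<close>; there are finitely many, so one of them has \<open>x\<close> in
  its closure.\<close>

lemma face_on_side:
  assumes C: "gcycle C" "C \<subseteq> E" "e \<in> C" and x: "x \<in> interior_of_edge e"
    and X: "X = inside (drawn C) \<or> X = outside (drawn C)"
  shows "\<exists>f\<in>faces. x \<in> closure f \<and> f \<subseteq> X"
proof -
  let ?D = "drawing (E - {e})"
  have eE: "e \<in> E" using C by blast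
  have xC: "x \<in> drawn C" using x C by (auto simp: drawn_def interior_of_edge_def)
  have "X \<subseteq> - drawn C" using X cycle_sides(7)[OF C(1,2)] by blast
  then have X': "frontier X = drawn C" "X \<inter> drawn C = {}"
    using X cycle_sides(5,6)[OF C(1,2)] by auto
  have "x \<in> closure X" using X'(1) xC by (auto simp: frontier_def)
  moreover have "open (- ?D)" using compact_drawing[of "E - {e}"] by (auto intro: compact_imp_closed)
  moreover have "x \<in> - ?D" using interior_of_edge_disjoint[OF eE, of "E - {e}"] x by auto
  ultimately have "x \<in> closure (X \<inter> - ?D)"
    using open_Int_closure_subset[of "- ?D" X] by (auto simp: Int_commute)
  moreover have "X \<inter> - ?D \<subseteq> \<Union>{f \<in> faces. f \<subseteq> X}"
  proof
    fix y assume y: "y \<in> X \<inter> - ?D"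
    have "drawing E \<subseteq> ?D \<union> drawn C" using C(3) unfolding drawing_def drawn_def by blast
    then have "y \<notin> drawing E" using X'(2) y by blast
    then obtain f where f: "f \<in> faces" "y \<in> f" using in_some_face by blast
    have "f \<subseteq> X"
    proof (rule ccontr)
      assume "\<not> f \<subseteq> X"
      then have "f \<inter> frontier X \<noteq> {}" using f y face_connected by (intro connected_Int_frontier) auto
      then show False using X'(1) face_avoids_drawn[OF f(1) C(2)] by blast
    qed
    then show "y \<in> \<Union>{f \<in> faces. f \<subseteq> X}" using f by blast
  qed
  ultimately have "x \<in> closure (\<Union>{f \<in> faces. f \<subseteq> X})" using closure_mono by blast
  then show ?thesis using finite_faces by (subst (asm) closure_Union_finite) auto
qed

lemma faces_at_cycle_edge:
  assumes C: "gcycle C" "C \<subseteq> E" "e \<in> C" and x: "x \<in> interior_of_edge e"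
  shows "\<exists>f\<in>faces. \<exists>g\<in>faces. x \<in> closure f \<and> x \<in> closure g \<and> e \<in> face_boundary f \<and> e \<in> face_boundary g \<and> in_inside C f \<and> \<not> in_inside C g"
proof -
  obtain f where f: "f \<in> faces" "x \<in> closure f" "f \<subseteq> inside (drawn C)"
    using face_on_side[OF C x] by blast
  obtain g where g: "g \<in> faces" "x \<in> closure g" "g \<subseteq> outside (drawn C)"
    using face_on_side[OF C x] by blast
  have "\<not> in_inside C g"
    using g face_nonempty[OF g(1)] inside_Int_outside[of "drawn C"] unfolding in_inside_def by blast
  moreover have "e \<in> E" using C by blast
  ultimately show ?thesis using f g C x unfolding face_boundary_def in_inside_def by blast
qed

lemma boundary_edge_other_face:
  assumes "f \<in> faces" "e \<in> face_boundary f"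
  shows "\<exists>g\<in>faces. g \<noteq> f \<and> e \<in> face_boundary g"
proof -
  obtain C where C: "gcycle C" "C \<subseteq> E" "e \<in> C" using assms by (auto simp: face_boundary_def)
  obtain x where "x \<in> interior_of_edge e" using interior_of_edge_connected C by blast
  then show ?thesis using faces_at_cycle_edge[OF C] by metis
qed

text \<open>Some cycle in the boundary of \<open>f\<close> separates \<open>f\<close> from the face
  across \<open>e\<close>, and by \<open>crossing_iff\<close> it contains \<open>e\<close>.\<close>

lemma boundary_edge_on_cycle:
  assumes "f \<in> faces" "e \<in> face_boundary f"
  shows "\<exists>C. gcycle C \<and> C \<subseteq> face_boundary f \<and> e \<in> C"
proof -
  obtain g where g: "g \<in> faces" "g \<noteq> f" "e \<in> face_boundary g" using boundary_edge_other_face assms by blast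
  then obtain C where "gcycle C" "C \<subseteq> face_boundary f" "in_inside C f \<noteq> in_inside C g"
    using faces_separated assms by metis
  then show ?thesis using crossing_iff[of f g e C] assms g face_boundary_subset by blast
qed

text \<open>Three faces at \<open>e\<close> would lie pairwise on different sides of a cycle through
  \<open>e\<close>, which has only two sides.\<close>

lemma faces_at_edge_le_2: "card {f \<in> faces. e \<in> face_boundary f} \<le> 2"
proof (rule ccontr)
  assume "\<not> ?thesis"
  then have "3 \<le> card {f \<in> faces. e \<in> face_boundary f}" by simp
  then obtain X where X: "X \<subseteq> {f \<in> faces. e \<in> face_boundary f}" "card X = 3"
    by (rule obtain_subset_with_card_n)
  then obtain f g h where fgh: "f \<in> X" "g \<in> X" "h \<in> X" "f \<noteq> g" "f \<noteq> h" "g \<noteq> h"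
    by (auto simp: card_3_iff)
  obtain C where C: "gcycle C" "C \<subseteq> E" "e \<in> C"
    using fgh(1) X by (auto simp: face_boundary_def)
  have F: "f \<in> faces" "g \<in> faces" "h \<in> faces"
    "e \<in> face_boundary f" "e \<in> face_boundary g" "e \<in> face_boundary h"
    using fgh(1-3) X(1) by auto
  have "in_inside C f \<noteq> in_inside C g" "in_inside C f \<noteq> in_inside C h" "in_inside C g \<noteq> in_inside C h"
    using crossing_iff[of f g e C] crossing_iff[of f h e C] crossing_iff[of g h e C] F fgh(4-6) C by simp_all
  then show False by simp
qed

text \<open>This is the connectedness of the dual graph. The edges on no cycle form a forest
  \<open>B\<close>, whose drawing does not separate the plane. The closures of the two groups of
  faces cover the complement of \<open>drawing B\<close> and therefore meet there. A meeting point
  lies inside an edge of some cycle, and this edge is on the boundary of a face from each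
  group.\<close>

lemma faces_linked:
  assumes "A \<subseteq> faces" "A \<noteq> {}" "A \<noteq> faces"
  shows "\<exists>f\<in>A. \<exists>g\<in>faces - A. \<exists>e. e \<in> face_boundary f \<and> e \<in> face_boundary g"
proof -
  define B where "B = {e \<in> E. \<not> (\<exists>C. gcycle C \<and> C \<subseteq> E \<and> e \<in> C)}"
  have BE: "B \<subseteq> E" by (auto simp: B_def)
  have "connected_component (- drawing B) a b" if "a \<notin> drawing B" "b \<notin> drawing B" for a b
  proof (rule separated_by_cycle[OF BE that])
    fix C assume "gcycle C" "C \<subseteq> B"
    then show "connected_component (- drawn C) a b"
      using gcycle_nonempty unfolding B_def by blast
  qed
  then have con: "connected (- drawing B)" by (auto simp: connected_iff_connected_component)
  define X where "X = closure (\<Union>A)"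
  define Y where "Y = closure (\<Union>(faces - A))"
  have fin: "finite A" "finite (faces - A)" using finite_faces assms(1) finite_subset by auto
  have XY: "X = (\<Union>f\<in>A. closure f)" "Y = (\<Union>f\<in>faces - A. closure f)"
    unfolding X_def Y_def using fin by (auto simp: closure_Union_finite)
  have nonempty: "\<exists>x. x \<in> Z \<and> x \<notin> drawing B" if "g \<in> faces" "closure g \<subseteq> Z" for g Z
    using face_nonempty[OF that(1)] face_subset[OF that(1)] drawing_mono[OF BE] that(2) closure_subset by blast
  have cover: "- drawing B \<subseteq> X \<union> Y"
  proof
    fix z assume z: "z \<in> - drawing B"
    have "\<exists>f\<in>faces. z \<in> closure f"
    proof (cases "z \<in> drawing E")
      case False
      then show ?thesis using in_some_face closure_subset by blast
    next
      case True
      then obtain e where e: "e \<in> E" "z \<in> I e" "z \<notin> \<phi> ` V" using z by (auto simp: drawing_def drawn_def)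
      then have "e \<notin> B" using z by (auto simp: drawing_def drawn_def)
      then obtain C where "gcycle C" "C \<subseteq> E" "e \<in> C" using e by (auto simp: B_def)
      moreover have "z \<in> interior_of_edge e" using e edge_subset_V by (auto simp: interior_of_edge_def)
      ultimately show ?thesis using faces_at_cycle_edge by blast
    qed
    then show "z \<in> X \<union> Y" unfolding XY by blast
  qed
  have "X \<inter> Y \<inter> - drawing B \<noteq> {}"
  proof
    assume emp: "X \<inter> Y \<inter> - drawing B = {}"
    obtain f g where "f \<in> A" "g \<in> faces - A" using assms by blast
    then have "X \<inter> - drawing B \<noteq> {}" "Y \<inter> - drawing B \<noteq> {}"
      using nonempty[of f X] nonempty[of g Y] assms(1) XY by blast+
    moreover have "closed X" "closed Y" unfolding X_def Y_def by auto
    ultimately show False using con cover emp unfolding connected_closed by blast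
  qed
  then obtain x f g where x: "f \<in> A" "g \<in> faces - A" "x \<in> closure f" "x \<in> closure g" "x \<notin> drawing B"
    unfolding XY by blast
  have "f \<in> faces" "g \<in> faces" "f \<noteq> g" using x assms(1) by blast+
  then have disj: "f \<inter> closure g = {}" "g \<inter> closure f = {}"
    using faces_eqI face_open open_Int_closure_eq_empty by (metis disjoint_iff)+
  then have "x \<in> drawing E" using closure_face[of f x] x \<open>f \<in> faces\<close> by blast
  then obtain e where e: "e \<in> E" "x \<in> I e" "x \<notin> \<phi> ` V" using x(5) by (auto simp: drawing_def drawn_def)
  have "e \<notin> B" using e x(5) by (auto simp: drawing_def drawn_def)
  moreover have "x \<in> interior_of_edge e" using e edge_subset_V by (auto simp: interior_of_edge_def)
  ultimately have "e \<in> face_boundary f" "e \<in> face_boundary g"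
    using e x unfolding face_boundary_def B_def by blast+
  then show ?thesis using x by blast
qed

text \<open>Tree and cotree: a cycle that avoids the edges of a dual spanning tree separates no two faces.\<close>

lemma euler_inequality:
  assumes "V \<noteq> {}"
  shows "card E + 2 \<le> card V + card faces"
proof -
  have "faces \<noteq> {}"
  proof -
    have "- drawing E \<noteq> {}" using compact_drawing[of E] not_bounded_UNIV[where 'a=complex]
      by (metis Compl_empty_eq Compl_eq_Diff_UNIV Diff_eq_empty_iff compact_imp_bounded subset_refl top.extremum_uniqueI)
    then show ?thesis using in_some_face by blast
  qed
  \<comment> \<open>\<open>A\<close> holds the \<open>n\<close> faces reached so far and
    \<open>T\<close> the edges crossed to reach them. A new face shares an edge of \<open>T\<close>
    with an earlier one, so a cycle avoiding \<open>T\<close> keeps all of \<open>A\<close> on one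
    side.\<close>
  have "\<exists>A\<subseteq>faces. \<exists>T\<subseteq>E. card A = n \<and> card T + 1 \<le> n \<and>
      (\<forall>C. gcycle C \<and> C \<subseteq> E \<and> C \<inter> T = {} \<longrightarrow> (\<forall>f\<in>A. \<forall>g\<in>A. in_inside C f = in_inside C g))"
    if "1 \<le> n" "n \<le> card faces" for n
    using that
  proof (induction n rule: dec_induct)
    case base
    obtain f where "f \<in> faces" using \<open>faces \<noteq> {}\<close> by blast
    then show ?case by (intro exI[of _ "{f}"] conjI exI[of _ "{}"]) auto
  next
    case (step n)
    then obtain A T where AT: "A \<subseteq> faces" "T \<subseteq> E" "card A = n" "card T + 1 \<le> n"
      and same: "\<forall>C. gcycle C \<and> C \<subseteq> E \<and> C \<inter> T = {} \<longrightarrow> (\<forall>f\<in>A. \<forall>g\<in>A. in_inside C f = in_inside C g)"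
      by auto
    have "A \<noteq> faces" "A \<noteq> {}" using AT(3) step by auto
    then obtain f g e where fg: "f \<in> A" "g \<in> faces" "g \<notin> A" "e \<in> face_boundary f" "e \<in> face_boundary g"
      using faces_linked[OF AT(1)] by blast
    have fin: "finite A" "finite T" using AT(1,2) finite_faces finite_E finite_subset by metis+
    have eE: "e \<in> E" using fg(4) face_boundary_subset by blast
    have fF: "f \<in> faces" "f \<noteq> g" using fg AT(1) by auto
    have "\<forall>h\<in>insert g A. \<forall>h'\<in>insert g A. in_inside C h = in_inside C h'"
      if "gcycle C" "C \<subseteq> E" "C \<inter> insert e T = {}" for C
    proof -
      have "in_inside C f = in_inside C g"
        using crossing_iff[OF fF(1) fg(2) fF(2) fg(4,5) that(1,2)] that(3) by simp
      moreover have "\<forall>h\<in>A. in_inside C h = in_inside C f"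
        using same that fg(1) by (metis Int_insert_right disjoint_insert(1))
      ultimately show ?thesis by auto
    qed
    note new = this
    show ?case
    proof (intro exI[of _ "insert g A"] exI[of _ "insert e T"] conjI allI impI)
      show "insert g A \<subseteq> faces" "insert e T \<subseteq> E" using AT(1,2) fg(2) eE by simp_all
      show "card (insert g A) = Suc n" using fg(3) fin AT(3) by simp
      show "card (insert e T) + 1 \<le> Suc n" using AT(4) card_insert_le_m1[of "Suc (card T)" T e] by simp
    qed (use new in blast)
  qed
  moreover have "1 \<le> card faces" using \<open>faces \<noteq> {}\<close> finite_faces by (simp add: Suc_leI card_gt_0_iff)
  ultimately obtain A T where AT: "A \<subseteq> faces" "T \<subseteq> E" "card A = card faces" "card T + 1 \<le> card faces"
    and same: "\<And>C f g. gcycle C \<Longrightarrow> C \<subseteq> E \<Longrightarrow> C \<inter> T = {} \<Longrightarrow> f \<in> A \<Longrightarrow> g \<in> A \<Longrightarrow> in_inside C f = in_inside C g"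
    by (metis order_refl)
  have A: "A = faces" using AT(1,3) finite_faces by (simp add: card_subset_eq)
  have "card (E - T) < card V"
  proof (rule acyclic_card_less)
    fix C :: "'a set set" assume C: "gcycle C"
    show "\<not> C \<subseteq> E - T"
    proof
      assume sub: "C \<subseteq> E - T"
      then have CE: "C \<subseteq> E" "C \<inter> T = {}" by auto
      obtain e where e: "e \<in> C" using gcycle_nonempty[OF C] by blast
      obtain x where "x \<in> interior_of_edge e" using interior_of_edge_connected e CE by blast
      then show False using faces_at_cycle_edge[OF C CE(1) e] same[OF C CE] unfolding A by blast
    qed
  qed (use finite_E finite_V assms edgeD in auto)
  moreover have "card E = card (E - T) + card T"
    using AT(2) finite_E by (simp add: card_Diff_subset card_mono finite_subset)
  ultimately show ?thesis using AT(4) by linarith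
qed

end

section \<open>Discharging\<close>

locale no_4_6_cycles =
  fixes E :: "'a set set"
  assumes no_4_6: "gcycle C \<Longrightarrow> C \<subseteq> E \<Longrightarrow> card C \<noteq> 4 \<and> card C \<noteq> 6"
begin

definition k_cycle :: "nat \<Rightarrow> 'a set set \<Rightarrow> bool" where
  "k_cycle k C \<longleftrightarrow> gcycle C \<and> C \<subseteq> E \<and> card C = k"

definition in_k_cycle :: "nat \<Rightarrow> 'a set \<Rightarrow> bool" where
  "in_k_cycle k e \<longleftrightarrow> (\<exists>C. k_cycle k C \<and> e \<in> C)"

lemma no_list:
  assumes "distinct xs" "length xs = 4 \<or> length xs = 6" "insert {hd xs, last xs} (pedges xs) \<subseteq> E"
  shows False
proof -
  have l: "3 \<le> length xs" using assms(2) by auto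
  show False using no_4_6[OF gcycleI[OF assms(1) l] assms(3)] gcycle_card[OF assms(1) l] assms(2) by simp
qed

lemma k_cycle_through:
  assumes "k_cycle k C" "{a, b} \<in> C"
  shows "\<exists>xs. distinct xs \<and> length xs = k \<and> hd xs = a \<and> last xs = b \<and> C = insert {a, b} (pedges xs)"
proof -
  obtain xs where xs: "distinct xs" "3 \<le> length xs" "hd xs = a" "last xs = b"
    "C = insert {a, b} (pedges xs)"
    using gcycle_path_through[of C a b] assms unfolding k_cycle_def by metis
  then have "length xs = k" using gcycle_card[OF xs(1,2)] assms(1) by (simp add: k_cycle_def)
  then show ?thesis using xs by blast
qed

lemma triangle_through:
  assumes "k_cycle 3 C" "{a, b} \<in> C"
  shows "\<exists>c. a \<noteq> b \<and> a \<noteq> c \<and> b \<noteq> c \<and> C = {{a, b}, {a, c}, {c, b}}"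
proof -
  obtain xs where xs: "distinct xs" "length xs = 3" "hd xs = a" "last xs = b"
    "C = insert {a, b} (pedges xs)" using k_cycle_through[OF assms] by blast
  obtain c where "xs = [a, c, b]"
    using xs(2-4) by (auto simp: numeral_3_eq_3 length_Suc_conv)
  then show ?thesis using xs by auto
qed

text \<open>Two triangles on the edge \<open>ab\<close> with different apexes \<open>c\<close> and
  \<open>d\<close> would contain the 4-cycle \<open>a c b d\<close>.\<close>

lemma triangle_unique:
  assumes "k_cycle 3 C" "k_cycle 3 C'" "e \<in> C" "e \<in> C'"
  shows "C = C'"
proof -
  obtain a b where e: "e = {a, b}" using gcycle_doubleton assms(1,3) unfolding k_cycle_def by metis
  obtain c where c: "a \<noteq> b" "a \<noteq> c" "b \<noteq> c" "C = {{a, b}, {a, c}, {c, b}}"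
    using triangle_through assms(1,3) e by blast
  obtain d where d: "a \<noteq> d" "b \<noteq> d" "C' = {{a, b}, {a, d}, {d, b}}"
    using triangle_through assms(2,4) e by blast
  have sub: "C \<subseteq> E" "C' \<subseteq> E" using assms by (auto simp: k_cycle_def)
  have "c = d"
  proof (rule ccontr)
    assume "c \<noteq> d"
    then show False
      using no_list[of "[a, c, b, d]"] c d sub by (simp add: insert_commute)
  qed
  then show ?thesis using c d by simp
qed

text \<open>If the apex \<open>c\<close> is off the 5-cycle, replacing \<open>ab\<close> by the path
  \<open>a c b\<close> gives a 6-cycle. If \<open>c\<close> is on it, an edge of the triangle is a
  chord that cuts off a 4-cycle.\<close>

lemma triangle_not_in_5_cycle:
  assumes "k_cycle 3 C" "k_cycle 5 C'" "e \<in> C" "e \<in> C'"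
  shows False
proof -
  obtain a b where e: "e = {a, b}" using gcycle_doubleton assms(1,3) unfolding k_cycle_def by metis
  obtain c where c: "a \<noteq> b" "a \<noteq> c" "b \<noteq> c" "C = {{a, b}, {a, c}, {c, b}}"
    using triangle_through assms(1,3) e by blast
  obtain xs where xs: "distinct xs" "length xs = 5" "hd xs = a" "last xs = b"
    "C' = insert {a, b} (pedges xs)" using k_cycle_through assms(2,4) e by blast
  obtain p q r where pqr: "xs = [a, p, q, r, b]"
    using xs(2-4) by (auto simp: eval_nat_numeral length_Suc_conv)
  have E: "{a, b} \<in> E" "{a, c} \<in> E" "{c, b} \<in> E" "{a, p} \<in> E" "{p, q} \<in> E" "{q, r} \<in> E" "{r, b} \<in> E"
    using assms(1,2) c(4) xs(5) pqr by (auto simp: k_cycle_def)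
  consider "c \<notin> set xs" | "c = p" | "c = q" | "c = r" using c pqr by auto
  then show False
  proof cases
    case 1
    then show False using no_list[of "[a, p, q, r, b, c]"] E xs(1) c(1-3) unfolding pqr
      by (auto simp: insert_commute)
  next
    case 2
    then show False using no_list[of "[p, q, r, b]"] E xs(1) unfolding pqr by (simp add: insert_commute)
  next
    case 3
    then show False using no_list[of "[a, p, q, b]"] E xs(1) unfolding pqr by (simp add: insert_commute)
  next
    case 4
    then show False using no_list[of "[a, p, q, r]"] E xs(1) unfolding pqr by (simp add: insert_commute)
  qed
qed

lemma cycle_lengths:
  assumes "gcycle C" "C \<subseteq> E"
  shows "k_cycle 3 C \<or> k_cycle 5 C \<or> 7 \<le> card C"
  using no_4_6[OF assms] gcycle_card_ge_3[OF assms(1)] assms unfolding k_cycle_def by linarith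

lemma cycle_through_triangle_edge:
  assumes "k_cycle 3 C" "e \<in> C" "gcycle D" "D \<subseteq> E" "e \<in> D"
  shows "D = C \<or> 7 \<le> card D"
  using cycle_lengths[OF assms(3,4)] triangle_unique[OF assms(1) _ assms(2,5)]
    triangle_not_in_5_cycle[OF assms(1) _ assms(2,5)] by blast

text \<open>A cycle through the third edge at \<open>v\<close> has to continue along one of the two
  triangle edges there. It is not the triangle itself, so it is long.\<close>

lemma third_edge_cycle_length:
  assumes C: "k_cycle 3 C" and e: "e1 \<in> C" "e2 \<in> C" "v \<in> e1" "v \<in> e2" "e1 \<noteq> e2"
    and at_v: "{e \<in> E. v \<in> e} = {e1, e2, e3}" and D: "gcycle D" "D \<subseteq> E" "e3 \<in> D" "e3 \<notin> C"
  shows "7 \<le> card D"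
proof -
  have "v \<in> e3" using at_v by blast
  then obtain e' where e': "e' \<in> D" "e' \<noteq> e3" "v \<in> e'" using gcycle_other_edge[OF D(1,3)] by blast
  then have "e' \<in> {e1, e2, e3}" using D(2) by (subst at_v[symmetric]) auto
  then have "e' \<in> C" using e(1,2) e'(2) by auto
  then show ?thesis using cycle_through_triangle_edge[OF C _ D(1,2)] e' D by blast
qed

lemma triangle_edges_at_vertex:
  assumes "k_cycle 3 C" "e1 \<in> C" "v \<in> e1"
  shows "\<exists>e2\<in>C. e2 \<noteq> e1 \<and> v \<in> e2 \<and> (\<forall>e\<in>C. v \<in> e \<longrightarrow> e = e1 \<or> e = e2)"
proof -
  obtain a b where "e1 = {a, b}" using gcycle_doubleton assms(1,2) unfolding k_cycle_def by metis
  then obtain b where e: "e1 = {v, b}" using assms(3) by (metis insertE insert_commute singletonD)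
  obtain c where c: "v \<noteq> b" "v \<noteq> c" "b \<noteq> c" "C = {{v, b}, {v, c}, {c, b}}"
    using triangle_through assms(1,2) e by blast
  show ?thesis
    by (rule bexI[of _ "{v, c}"]) (use c e in \<open>auto simp: doubleton_eq_iff\<close>)
qed

end

text \<open>This is the balance at a vertex of degree 3. \<open>Qi\<close> stands for the
  \<open>i\<close>-th edge having both ends of degree 3; then half of its value
  \<open>si - 1/3\<close> is charged here. The other constants are
  \<open>1 - 1/3 - 1/4 = 5/12\<close> and \<open>1 - 1/3 - 1/5 = 7/15\<close>, for a second end of
  degree at least 4 or at least 5. The final alternative distinguishes whether the vertex lies on a
  triangle, formed with the first two edges.\<close>

lemma payment_arithmetic:
  fixes p1 p2 p3 s1 s2 s3 :: real
  assumes "Q1 \<and> p1 = s1 / 2 - 1/6 \<or> \<not> Q1 \<and> p1 \<le> s1 - 5/12"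
    and "Q2 \<and> p2 = s2 / 2 - 1/6 \<or> \<not> Q2 \<and> p2 \<le> s2 - 5/12"
    and "Q3 \<and> p3 = s3 / 2 - 1/6 \<or> \<not> Q3 \<and> p3 \<le> s3 - 5/12"
    and "Q1 \<Longrightarrow> \<not> Q2 \<and> p2 \<le> s2 - 7/15" "Q1 \<Longrightarrow> \<not> Q3 \<and> p3 \<le> s3 - 7/15"
    and "Q2 \<Longrightarrow> \<not> Q1 \<and> p1 \<le> s1 - 7/15" "Q2 \<Longrightarrow> \<not> Q3 \<and> p3 \<le> s3 - 7/15"
    and "Q3 \<Longrightarrow> \<not> Q1 \<and> p1 \<le> s1 - 7/15" "Q3 \<Longrightarrow> \<not> Q2 \<and> p2 \<le> s2 - 7/15"
    and "s1 \<le> 10/21 \<and> s2 \<le> 10/21 \<and> s3 \<le> 2/7 \<or> s1 \<le> 2/5 \<and> s2 \<le> 2/5 \<and> s3 \<le> 2/5"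
  shows "p1 + p2 + p3 \<le> 0"
  using assms by argo

text \<open>These are the plane graphs without a reducible configuration;
  \<open>no_such_graph\<close> shows that there are none. The last assumption speaks of neighbours
  of \<open>u\<close> and covers those of \<open>v\<close> by symmetry.\<close>

locale plane_graph_no_4_6 = plane_graph V E \<phi> I + no_4_6_cycles E
  for V :: "'a set" and E \<phi> I +
  assumes min_degree: "v \<in> V \<Longrightarrow> 3 \<le> card {e \<in> E. v \<in> e}"
    and nonempty: "V \<noteq> {}"
    and adjacent_3_vertices: "{u, v} \<in> E \<Longrightarrow> u \<noteq> v \<Longrightarrow> card {e \<in> E. u \<in> e} = 3 \<Longrightarrow> card {e \<in> E. v \<in> e} = 3 \<Longrightarrow>
      {u, w} \<in> E \<Longrightarrow> w \<noteq> v \<Longrightarrow> 5 \<le> card {e \<in> E. w \<in> e}"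
begin

definition degree :: "'a \<Rightarrow> nat" where "degree v = card {e \<in> E. v \<in> e}"

lemma sum_incidences:
  fixes h :: "'a \<Rightarrow> 'a set \<Rightarrow> real"
  shows "(\<Sum>v\<in>V. \<Sum>e\<in>{e \<in> E. v \<in> e}. h v e) = (\<Sum>e\<in>E. \<Sum>v\<in>e. h v e)"
proof -
  have "(\<Sum>v\<in>V. \<Sum>e\<in>{e \<in> E. v \<in> e}. h v e) = (\<Sum>e\<in>E. \<Sum>v\<in>{v \<in> V. v \<in> e}. h v e)"
    using finite_V finite_E by (rule sum.swap_restrict)
  also have "\<dots> = (\<Sum>e\<in>E. \<Sum>v\<in>e. h v e)"
    using edge_subset_V by (intro sum.cong refl) auto
  finally show ?thesis .
qed

text \<open>Minimum degree 3 turns Euler's inequality into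
  \<open>2 * card faces \<ge> card V + 4 \<ge> 7\<close>. Four faces guarantee a face different from
  any three given ones, which the arguments about triangular boundaries rely on.\<close>

lemma four_faces: "4 \<le> card faces"
proof -
  have "3 * card V \<le> 2 * card E"
  proof -
    have "3 * real (card V) = (\<Sum>v\<in>V. 3)" by simp
    also have "\<dots> \<le> (\<Sum>v\<in>V. \<Sum>e\<in>{e \<in> E. v \<in> e}. 1)"
      using min_degree by (intro sum_mono) force
    also have "\<dots> = (\<Sum>e\<in>E. \<Sum>v\<in>e. 1)" by (rule sum_incidences)
    also have "\<dots> = (\<Sum>e\<in>E. 2)"
    proof (rule sum.cong)
      fix e assume "e \<in> E"
      then obtain u v where "e = {u, v}" "u \<noteq> v" using edgeD by blast
      then show "(\<Sum>v\<in>e. 1) = (2::real)" by simp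
    qed simp
    finally show ?thesis by simp
  qed
  moreover have "3 \<le> card V"
  proof -
    obtain v where v: "v \<in> V" using nonempty by blast
    obtain X where X: "X \<subseteq> {e \<in> E. v \<in> e}" "card X = 3"
      using obtain_subset_with_card_n[OF min_degree[OF v]] by metis
    then obtain e1 e2 where e: "e1 \<in> E" "v \<in> e1" "e2 \<in> E" "v \<in> e2" "e1 \<noteq> e2"
      by (auto simp: card_3_iff)
    have "\<exists>w. e' = {v, w} \<and> w \<noteq> v" if "e' \<in> E" "v \<in> e'" for e'
      using edgeD[OF that(1)] that(2) by (metis insertE insert_commute singletonD)
    then obtain a b where ab: "e1 = {v, a}" "a \<noteq> v" "e2 = {v, b}" "b \<noteq> v" using e by metis
    have "card {v, a, b} \<le> card V"
      using ab e edge_subset_V finite_V by (intro card_mono) auto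
    moreover have "a \<noteq> b" using ab e by auto
    ultimately show ?thesis using ab by simp
  qed
  ultimately show ?thesis using euler_inequality[OF nonempty] by linarith
qed

section \<open>Boundaries and shares of faces at triangles\<close>

definition face_length :: "complex set \<Rightarrow> nat" where "face_length f = card (face_boundary f)"

lemma finite_face_boundary: "finite (face_boundary f)"
  using face_boundary_subset finite_E by (rule finite_subset)

lemma other_face: "\<exists>h\<in>faces. h \<noteq> f \<and> h \<noteq> g \<and> h \<noteq> k"
proof (rule ccontr)
  assume "\<not> ?thesis"
  then have "faces \<subseteq> {f, g, k}" by blast
  then have "card faces \<le> card {f, g, k}" by (intro card_mono) auto
  also have "\<dots> \<le> 3" by (simp add: card_insert_if)
  finally show False using four_faces by simp
qed

lemma face_boundary_nonempty: "f \<in> faces \<Longrightarrow> face_boundary f \<noteq> {}"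
  using other_face[of f f f] faces_separated[of f] gcycle_nonempty by blast

text \<open>Some cycle in the boundary of \<open>f\<close> separates \<open>f\<close> from
  \<open>g\<close>, and the only cycle contained in a triangle is the triangle.\<close>

lemma separated_by_boundary_triangle:
  assumes C: "k_cycle 3 C" and f: "f \<in> faces" "face_boundary f = C" and g: "g \<in> faces" "g \<noteq> f"
  shows "in_inside C f \<noteq> in_inside C g"
proof -
  obtain D where D: "gcycle D" "D \<subseteq> C" "in_inside D f \<noteq> in_inside D g"
    using faces_separated[of f g] f g by metis
  have "finite C" "card C = 3" using C gcycle_finite by (auto simp: k_cycle_def)
  then have "D = C" using gcycle_card_ge_3[OF D(1)] D(2) by (metis card_seteq)
  then show ?thesis using D by simp
qed

text \<open>The two faces and any third one would lie pairwise on different sides of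
  \<open>C\<close>.\<close>

lemma no_two_faces_with_same_triangle:
  assumes "k_cycle 3 C" "f \<in> faces" "g \<in> faces" "face_boundary f = C" "face_boundary g = C"
  shows "f = g"
proof (rule ccontr)
  assume "f \<noteq> g"
  obtain h where "h \<in> faces" "h \<noteq> f" "h \<noteq> g" using other_face by metis
  then show False
    using separated_by_boundary_triangle[OF assms(1)] assms \<open>f \<noteq> g\<close> by metis
qed

text \<open>Every boundary edge lies on a cycle inside the boundary, here with fewer than 7 edges.
  The one through \<open>e\<close> is therefore \<open>C\<close>. A boundary edge outside
  \<open>C\<close> lies on such a cycle disjoint from \<open>C\<close>, for which only three edges
  remain: a second triangle.\<close>

lemma face_at_triangle_edge:
  assumes C: "k_cycle 3 C" "e \<in> C" and f: "f \<in> faces" "e \<in> face_boundary f" and len: "face_length f < 7"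
  shows "face_boundary f = C \<or>
    (face_length f = 6 \<and> (\<exists>C'. k_cycle 3 C' \<and> C \<inter> C' = {} \<and> face_boundary f = C \<union> C'))"
proof -
  let ?B = "face_boundary f"
  have small: "card D < 7" if "D \<subseteq> ?B" for D
    using card_mono[OF finite_face_boundary that] len unfolding face_length_def by linarith
  obtain D where D: "gcycle D" "D \<subseteq> ?B" "e \<in> D" using boundary_edge_on_cycle[OF f] by blast
  then have "D = C"
    using cycle_through_triangle_edge[OF C D(1) _ D(3)] face_boundary_subset small[OF D(2)] by fastforce
  show ?thesis
  proof (cases "?B = C")
    case False
    then obtain e' where e': "e' \<in> ?B" "e' \<notin> C" using D \<open>D = C\<close> by blast
    obtain D' where D': "gcycle D'" "D' \<subseteq> ?B" "e' \<in> D'" using boundary_edge_on_cycle[OF f(1) e'(1)] by blast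
    have D'E: "D' \<subseteq> E" using D'(2) face_boundary_subset by blast
    have disj: "C \<inter> D' = {}"
    proof (rule ccontr)
      assume "C \<inter> D' \<noteq> {}"
      then obtain x where x: "x \<in> C" "x \<in> D'" by blast
      then have "D' = C"
        using cycle_through_triangle_edge[OF C(1) x(1) D'(1) D'E x(2)] small[OF D'(2)] by simp
      then show False using e' D' by blast
    qed
    have fin: "finite C" "finite D'" using C D'(1) gcycle_finite by (auto simp: k_cycle_def)
    have sub: "C \<union> D' \<subseteq> ?B" using D D' \<open>D = C\<close> by blast
    have "card (C \<union> D') = 3 + card D'" using fin disj C(1) by (simp add: card_Un_disjoint k_cycle_def)
    moreover have "card (C \<union> D') < 7" by (rule small[OF sub])
    ultimately have tri: "k_cycle 3 D'" and "card (C \<union> D') = 6"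
      using cycle_lengths[OF D'(1) D'E] by (auto simp: k_cycle_def)
    moreover have "card ?B \<le> 6" using len by (simp add: face_length_def)
    ultimately have "C \<union> D' = ?B" using card_seteq[OF finite_face_boundary sub] by simp
    then show ?thesis using tri disj \<open>card (C \<union> D') = 6\<close> by (auto simp: face_length_def)
  qed simp
qed

lemma length_3_face_boundary:
  assumes C: "k_cycle 3 C" "e \<in> C" and f: "f \<in> faces" "e \<in> face_boundary f" "face_length f = 3"
  shows "face_boundary f = C"
  using face_at_triangle_edge[OF C f(1,2)] f(3) by simp

text \<open>Such an edge already receives \<open>1/3\<close> from its other side, so
  \<open>f\<close> may give it no more than \<open>1/7\<close>.\<close>

definition isolated_at :: "complex set \<Rightarrow> 'a set \<Rightarrow> bool" where
  "isolated_at f e \<longleftrightarrow> (\<exists>g\<in>faces. g \<noteq> f \<and> e \<in> face_boundary g \<and> face_length g = 3)"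

text \<open>
  A face spreads a total of at least 1 over its boundary. A face bounded by two edge-disjoint
  triangles favours the triangle whose other side is not a face of length 3, so that no
  triangle edge receives more than \<open>1/3 + 1/7\<close>.
\<close>

definition share :: "complex set \<Rightarrow> 'a set \<Rightarrow> real" where
  "share f e = (if face_length f = 6 \<and> in_k_cycle 3 e
     then (if isolated_at f e then 1/7 else 4/21) else 1 / face_length f)"

text \<open>Otherwise \<open>C\<close> and \<open>C'\<close> bound faces \<open>g\<close> and
  \<open>g'\<close> of length 3; let \<open>h\<close> be a fourth face. Each triangle separates its
  own face from all others, so \<open>f\<close> and \<open>h\<close> are on the same side of both
  triangles. But \<open>f\<close> and \<open>h\<close> are separated by a cycle in
  \<open>C \<union> C'\<close>, and with at most 6 edges this cycle can only be \<open>C\<close> or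
  \<open>C'\<close>.\<close>

lemma not_both_isolated:
  assumes C: "k_cycle 3 C" "k_cycle 3 C'" "C \<inter> C' = {}"
    and f: "f \<in> faces" "face_boundary f = C \<union> C'" and e: "e \<in> C" "e' \<in> C'"
    and iso: "isolated_at f e" "isolated_at f e'"
  shows False
proof -
  obtain g where g: "g \<in> faces" "g \<noteq> f" "face_boundary g = C"
    using iso(1) length_3_face_boundary[OF C(1) e(1)] unfolding isolated_at_def by blast
  obtain g' where g': "g' \<in> faces" "g' \<noteq> f" "face_boundary g' = C'"
    using iso(2) length_3_face_boundary[OF C(2) e(2)] unfolding isolated_at_def by blast
  obtain h where h: "h \<in> faces" "h \<noteq> f" "h \<noteq> g" "h \<noteq> g'" using other_face by metis
  have "in_inside C f = in_inside C h"
    using separated_by_boundary_triangle[OF C(1) g(1,3)] f(1) h g(2) by metis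
  moreover have "in_inside C' f = in_inside C' h"
    using separated_by_boundary_triangle[OF C(2) g'(1,3)] f(1) h g'(2) by metis
  moreover obtain D where D: "gcycle D" "D \<subseteq> C \<union> C'" "in_inside D f \<noteq> in_inside D h"
    using faces_separated[of f h] f h by metis
  moreover have "D = C \<or> D = C'"
  proof -
    have sub: "C \<union> C' \<subseteq> E" using C by (auto simp: k_cycle_def)
    have "finite (C \<union> C')" using C gcycle_finite by (auto simp: k_cycle_def)
    then have "card D \<le> card (C \<union> C')" using D(2) by (intro card_mono)
    also have "\<dots> \<le> 6" using card_Un_le[of C C'] C by (simp add: k_cycle_def)
    finally have "card D < 7" by simp
    moreover obtain x where "x \<in> D" using gcycle_nonempty[OF D(1)] by blast
    ultimately show ?thesis
      using cycle_through_triangle_edge[OF C(1) _ D(1), of x] cycle_through_triangle_edge[OF C(2) _ D(1), of x]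
        D(2) sub by fastforce
  qed
  ultimately show False by blast
qed

text \<open>Without redistribution the shares add up to exactly 1. In a face bounded by two
  triangles, one triangle has no isolated edge and gets \<open>4/21\<close> on each edge, while the
  other gets at least \<open>1/7\<close> on each. The value \<open>4/21 = 1/3 - 1/7\<close> is
  chosen so that these sum to 1.\<close>

lemma share_sum: "f \<in> faces \<Longrightarrow> 1 \<le> (\<Sum>e\<in>face_boundary f. share f e)"
proof -
  assume f: "f \<in> faces"
  let ?B = "face_boundary f"
  show ?thesis
  proof (cases "face_length f = 6 \<and> (\<exists>e\<in>?B. in_k_cycle 3 e)")
    case False
    then have "share f e = 1 / face_length f" if "e \<in> ?B" for e
      using that by (auto simp: share_def)
    then have "(\<Sum>e\<in>?B. share f e) = (\<Sum>e\<in>?B. 1 / face_length f)" by simp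
    also have "\<dots> = 1" using face_boundary_nonempty[OF f] finite_face_boundary[of f]
      by (simp add: face_length_def)
    finally show ?thesis by simp
  next
    case True
    then obtain e C where e: "e \<in> ?B" "k_cycle 3 C" "e \<in> C" by (auto simp: in_k_cycle_def)
    have six: "face_length f = 6" using True by simp
    have "?B \<noteq> C" using six e(2) by (auto simp: face_length_def k_cycle_def)
    then obtain C' where C': "k_cycle 3 C'" "C \<inter> C' = {}" "?B = C \<union> C'"
      using face_at_triangle_edge[OF e(2,3) f e(1)] six by auto
    have lower: "1/7 \<le> share f x" "\<not> isolated_at f x \<Longrightarrow> share f x = 4/21" if "x \<in> ?B" for x
    proof -
      have "in_k_cycle 3 x" using that C' e(2) by (auto simp: in_k_cycle_def)
      then show "1/7 \<le> share f x" "\<not> isolated_at f x \<Longrightarrow> share f x = 4/21"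
        using six by (auto simp: share_def)
    qed
    have *: "1 \<le> (\<Sum>x\<in>X. share f x) + (\<Sum>x\<in>Y. share f x)"
      if "card X = 3" "card Y = 3" "X \<subseteq> ?B" "Y \<subseteq> ?B" "\<forall>x\<in>X. \<not> isolated_at f x" for X Y
    proof -
      have "(\<Sum>x\<in>X. share f x) = (\<Sum>x\<in>X. 4/21)" using lower(2) that by (intro sum.cong) auto
      moreover have "(\<Sum>x\<in>Y. 1/7) \<le> (\<Sum>x\<in>Y. share f x)" using lower(1) that by (intro sum_mono) auto
      ultimately show ?thesis using that(1,2) by simp
    qed
    have card: "card C = 3" "card C' = 3" using e(2) C'(1) by (auto simp: k_cycle_def)
    have "finite C" "finite C'" using e(2) C'(1) gcycle_finite by (auto simp: k_cycle_def)
    then have "(\<Sum>x\<in>?B. share f x) = (\<Sum>x\<in>C. share f x) + (\<Sum>x\<in>C'. share f x)"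
      unfolding C'(3) using C'(2) by (intro sum.union_disjoint)
    moreover have "(\<forall>x\<in>C. \<not> isolated_at f x) \<or> (\<forall>x\<in>C'. \<not> isolated_at f x)"
      using not_both_isolated[OF e(2) C' (1,2) f C'(3)] by blast
    ultimately show ?thesis
      using *[of C C'] *[of C' C] card C'(3) by auto
  qed
qed

definition edge_share :: "'a set \<Rightarrow> real" where
  "edge_share e = (\<Sum>f\<in>{f \<in> faces. e \<in> face_boundary f}. share f e)"

lemma edge_share_le:
  assumes "0 \<le> c" and "\<And>f. f \<in> faces \<Longrightarrow> e \<in> face_boundary f \<Longrightarrow> share f e \<le> c"
  shows "edge_share e \<le> 2 * c"
proof -
  have "edge_share e \<le> (\<Sum>f\<in>{f \<in> faces. e \<in> face_boundary f}. c)"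
    unfolding edge_share_def using assms(2) by (intro sum_mono) auto
  also have "\<dots> = real (card {f \<in> faces. e \<in> face_boundary f}) * c" by simp
  also have "\<dots> \<le> 2 * c" using faces_at_edge_le_2[of e] assms(1) by (intro mult_right_mono) auto
  finally show ?thesis .
qed

text \<open>The boundary of a face at \<open>e\<close> contains a cycle through \<open>e\<close>, so
  the face has length at least 5, and at least 7 if 5-cycles are ruled out too.\<close>

lemma edge_share_not_in_triangle:
  assumes "\<not> in_k_cycle 3 e"
  shows "edge_share e \<le> 2/5" and "\<not> in_k_cycle 5 e \<Longrightarrow> edge_share e \<le> 2/7"
proof -
  have len: "5 \<le> face_length f" "\<not> in_k_cycle 5 e \<Longrightarrow> 7 \<le> face_length f"
    if f: "f \<in> faces" "e \<in> face_boundary f" for f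
  proof -
    obtain D where D: "gcycle D" "D \<subseteq> face_boundary f" "e \<in> D" using boundary_edge_on_cycle[OF f] by blast
    then have "card D \<le> face_length f"
      unfolding face_length_def using finite_face_boundary by (intro card_mono)
    moreover have "k_cycle 5 D \<or> 7 \<le> card D"
      using cycle_lengths[OF D(1)] D face_boundary_subset assms unfolding in_k_cycle_def by blast
    ultimately show "5 \<le> face_length f" "\<not> in_k_cycle 5 e \<Longrightarrow> 7 \<le> face_length f"
      using D(3) by (auto simp: k_cycle_def in_k_cycle_def)
  qed
  have share: "share f e \<le> 1 / real n" if "0 < n" "n \<le> face_length f" for f n
    using assms that by (simp add: share_def frac_le)
  have "edge_share e \<le> 2 * (1 / real 5)"
    using share len(1) by (intro edge_share_le) (simp_all del: of_nat_numeral)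
  then show "edge_share e \<le> 2/5" by simp
  assume "\<not> in_k_cycle 5 e"
  then have "edge_share e \<le> 2 * (1 / real 7)"
    using share len(2) by (intro edge_share_le) (simp_all del: of_nat_numeral)
  then show "edge_share e \<le> 2/7" by simp
qed

text \<open>Two faces at \<open>e\<close> cannot both have length 3. If one has, then
  \<open>e\<close> is isolated at the other, which contributes at most \<open>1/7\<close>; if
  neither has, the sum is at most \<open>4/21 + 4/21\<close>, which is smaller than
  \<open>10/21\<close>.\<close>

lemma edge_share_in_triangle:
  assumes "in_k_cycle 3 e"
  shows "edge_share e \<le> 10/21"
proof -
  obtain C where C: "k_cycle 3 C" "e \<in> C" using assms by (auto simp: in_k_cycle_def)
  let ?F = "{f \<in> faces. e \<in> face_boundary f}"
  have lens: "face_length f = 3 \<or> face_length f = 6 \<or> 7 \<le> face_length f" if "f \<in> ?F" for f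
    using face_at_triangle_edge[OF C, of f] that C(1) by (fastforce simp: face_length_def k_cycle_def)
  have share: "share f e = 1/3 \<and> face_length f = 3 \<or> share f e = 1/7 \<and> isolated_at f e
      \<or> share f e \<le> 4/21 \<and> \<not> isolated_at f e \<or> share f e \<le> 1/7" if "f \<in> ?F" for f
    using lens[OF that] assms by (auto simp: share_def field_simps)
  have pair: "share f e + share g e \<le> 10/21" if "f \<in> ?F" "g \<in> ?F" "f \<noteq> g" for f g
  proof -
    have "\<not> (face_length f = 3 \<and> face_length g = 3)"
      using no_two_faces_with_same_triangle[OF C(1)] length_3_face_boundary[OF C] that by blast
    moreover have "face_length f = 3 \<Longrightarrow> isolated_at g e" "face_length g = 3 \<Longrightarrow> isolated_at f e"
      using that unfolding isolated_at_def by blast+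
    ultimately show ?thesis using share[OF that(1)] share[OF that(2)] by argo
  qed
  have fin: "finite ?F" using finite_faces by simp
  consider "?F = {}" | f where "?F = {f}" | f g where "?F = {f, g}" "f \<noteq> g"
  proof -
    have "card ?F = 0 \<or> card ?F = 1 \<or> card ?F = 2" using faces_at_edge_le_2[of e] by linarith
    then show ?thesis
    proof (elim disjE)
      assume "card ?F = 0"
      then show ?thesis using fin that(1) by simp
    next
      assume "card ?F = 1"
      then show ?thesis using that(2) by (rule card_1_singletonE)
    next
      assume "card ?F = 2"
      then show ?thesis using that(3) unfolding card_2_iff by blast
    qed
  qed
  then show ?thesis
  proof cases
    case 1
    then show ?thesis by (simp only: edge_share_def) simp
  next
    case 2
    then have "edge_share e = share f e" by (simp only: edge_share_def) simp
    moreover have "f \<in> ?F" using 2 by blast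
    ultimately show ?thesis using share[of f] by argo
  next
    case 3
    then have "edge_share e = share f e + share g e" by (simp only: edge_share_def) simp
    moreover have "f \<in> ?F" "g \<in> ?F" using 3 by blast+
    ultimately show ?thesis using pair[of f g] 3(2) by simp
  qed
qed

lemma edge_share_bound: "edge_share e \<le> 10/21"
  using edge_share_in_triangle[of e] edge_share_not_in_triangle(1)[of e] by argo

section \<open>Values of edges and their transfer to vertices of degree 3\<close>

definition edge_value :: "'a set \<Rightarrow> real" where
  "edge_value e = (\<Sum>v\<in>e. 1 / degree v) + edge_share e - 1"

text \<open>The reciprocal degrees around a vertex add up to 1 and the shares of a face to at least
  1, so the total is at least \<open>card V + card faces - card E\<close>.\<close>

lemma sum_edge_value: "2 \<le> (\<Sum>e\<in>E. edge_value e)"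
proof -
  have "(\<Sum>e\<in>E. \<Sum>v\<in>e. 1 / real (degree v)) = (\<Sum>v\<in>V. \<Sum>e\<in>{e \<in> E. v \<in> e}. 1 / degree v)"
    by (rule sum_incidences[symmetric])
  also have "\<dots> = (\<Sum>v\<in>V. 1)"
  proof (rule sum.cong)
    fix v assume "v \<in> V"
    then have "degree v \<noteq> 0" using min_degree[of v] by (simp add: degree_def)
    then show "(\<Sum>e\<in>{e \<in> E. v \<in> e}. 1 / degree v) = 1" by (simp add: degree_def)
  qed simp
  finally have 1: "(\<Sum>e\<in>E. \<Sum>v\<in>e. 1 / real (degree v)) = card V" by simp
  have "(\<Sum>e\<in>E. edge_share e) = (\<Sum>f\<in>faces. \<Sum>e\<in>{e \<in> E. e \<in> face_boundary f}. share f e)"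
    unfolding edge_share_def using finite_E finite_faces by (rule sum.swap_restrict)
  also have "\<dots> = (\<Sum>f\<in>faces. \<Sum>e\<in>face_boundary f. share f e)"
    using face_boundary_subset by (intro sum.cong refl) auto
  also have "\<dots> \<ge> (\<Sum>f\<in>faces. 1)" using share_sum by (intro sum_mono) auto
  finally have 2: "real (card faces) \<le> (\<Sum>e\<in>E. edge_share e)" by simp
  have "(\<Sum>e\<in>E. edge_value e) = card V + (\<Sum>e\<in>E. edge_share e) - card E"
    unfolding edge_value_def by (simp add: sum.distrib sum_subtractf 1)
  then show ?thesis using 2 euler_inequality[OF nonempty] by linarith
qed

text \<open>This is what an edge transfers to each of its ends of degree 3; the half keeps the total
  equal to its value when there are two such ends.\<close>

definition payment :: "'a set \<Rightarrow> real" where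
  "payment e = (if \<forall>w\<in>e. degree w = 3 then edge_value e / 2 else edge_value e)"

lemma payment_bounds:
  assumes e: "e \<in> E" "v \<in> e" and v: "degree v = 3"
  shows "\<forall>w\<in>e. degree w = 3 \<Longrightarrow> payment e = edge_share e / 2 - 1/6"
    and "\<not> (\<forall>w\<in>e. degree w = 3) \<Longrightarrow> payment e \<le> edge_share e - 5/12"
    and "\<not> (\<forall>w\<in>e. degree w = 3) \<Longrightarrow> \<forall>w\<in>e - {v}. 5 \<le> degree w \<Longrightarrow> payment e \<le> edge_share e - 7/15"
proof -
  obtain w where w: "e = {v, w}" "v \<noteq> w" "w \<in> V"
    using edgeD[OF e(1)] e(2) by (metis insertE insert_commute singletonD)
  have val: "edge_value e = 1 / 3 + 1 / degree w + edge_share e - 1"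
    using w v by (simp add: edge_value_def)
  have "3 \<le> degree w" using min_degree w(3) by (simp add: degree_def)
  show "payment e = edge_share e / 2 - 1/6" if "\<forall>w\<in>e. degree w = 3"
    using that w val by (simp add: payment_def)
  show "payment e \<le> edge_share e - 5/12" if "\<not> (\<forall>w\<in>e. degree w = 3)"
  proof -
    have "4 \<le> real (degree w)" using that w v \<open>3 \<le> degree w\<close> by auto
    then have "1 / real (degree w) \<le> 1/4" by (intro divide_left_mono) auto
    moreover have "payment e = edge_value e" using that by (simp only: payment_def if_False)
    ultimately show ?thesis using val by linarith
  qed
  show "payment e \<le> edge_share e - 7/15" if "\<not> (\<forall>w\<in>e. degree w = 3)" "\<forall>w\<in>e - {v}. 5 \<le> degree w"
  proof -
    have "5 \<le> real (degree w)" using that w by auto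
    then have "1 / real (degree w) \<le> 1/5" by (intro divide_left_mono) auto
    moreover have "payment e = edge_value e" using that(1) by (simp only: payment_def if_False)
    ultimately show ?thesis using val by linarith
  qed
qed

text \<open>If \<open>v\<close> is on a triangle, two of its edges belong to the triangle, and the
  third lies in no triangle or 5-cycle, so its share is at most \<open>2/7\<close>. If not, all
  three shares are at most \<open>2/5\<close>.\<close>

lemma payment_at_3_vertex:
  assumes v: "v \<in> V" "degree v = 3"
  shows "(\<Sum>e\<in>{e \<in> E. v \<in> e}. payment e) \<le> 0"
proof -
  let ?N = "{e \<in> E. v \<in> e}"
  let ?q = "\<lambda>e. \<forall>w\<in>e. degree w = 3"
  have N3: "card ?N = 3" using v(2) by (simp add: degree_def)
  have b: "?q e \<and> payment e = edge_share e / 2 - 1/6 \<or> \<not> ?q e \<and> payment e \<le> edge_share e - 5/12"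
    if "e \<in> ?N" for e using payment_bounds[of e v] that v(2) by blast
  \<comment> \<open>One neighbour of degree 3 forces the other two to have degree at least 5; in
    particular at most one edge at \<open>v\<close> satisfies \<open>?q\<close>.\<close>
  have b5: "\<not> ?q e' \<and> payment e' \<le> edge_share e' - 7/15"
    if ee': "e \<in> ?N" "e' \<in> ?N" "e \<noteq> e'" "?q e" for e e'
  proof -
    obtain u where u: "e = {v, u}" "v \<noteq> u"
      using edgeD[of e] ee'(1) by (metis (no_types, lifting) insertE insert_commute mem_Collect_eq singletonD)
    obtain w where w: "e' = {v, w}" "v \<noteq> w"
      using edgeD[of e'] ee'(2) by (metis (no_types, lifting) insertE insert_commute mem_Collect_eq singletonD)
    have "5 \<le> degree w"
      using adjacent_3_vertices[of v u w] ee' u w v(2) unfolding degree_def by auto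
    then show ?thesis using payment_bounds(3)[of e' v] ee'(2) w v(2) by auto
  qed
  have total: "payment e1 + payment e2 + payment e3 \<le> 0"
    if e: "e1 \<in> ?N" "e2 \<in> ?N" "e3 \<in> ?N" "e1 \<noteq> e2" "e1 \<noteq> e3" "e2 \<noteq> e3"
      and sh: "edge_share e1 \<le> 10/21 \<and> edge_share e2 \<le> 10/21 \<and> edge_share e3 \<le> 2/7 \<or>
        edge_share e1 \<le> 2/5 \<and> edge_share e2 \<le> 2/5 \<and> edge_share e3 \<le> 2/5" for e1 e2 e3
    using b[OF e(1)] b[OF e(2)] b[OF e(3)] b5[OF e(1,2,4)] b5[OF e(1,3,5)] b5[OF e(2,1) e(4)[symmetric]]
      b5[OF e(2,3,6)] b5[OF e(3,1) e(5)[symmetric]] b5[OF e(3,2) e(6)[symmetric]] sh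
    by (rule payment_arithmetic)
  show ?thesis
  proof (cases "\<exists>e\<in>?N. in_k_cycle 3 e")
    case True
    then obtain e1 C where e1: "e1 \<in> ?N" "k_cycle 3 C" "e1 \<in> C" by (auto simp: in_k_cycle_def)
    then obtain e2 where e2: "e2 \<in> C" "e2 \<noteq> e1" "v \<in> e2" "\<forall>e\<in>C. v \<in> e \<longrightarrow> e = e1 \<or> e = e2"
      using triangle_edges_at_vertex[of C e1 v] by blast
    have e2N: "e2 \<in> ?N" using e2 e1(2) by (auto simp: k_cycle_def)
    have "card (?N - {e1, e2}) = 1"
      using N3 e1(1) e2N e2(2) by (subst card_Diff_subset) auto
    then obtain e3 where "?N - {e1, e2} = {e3}" by (rule card_1_singletonE)
    then have N: "?N = {e1, e2, e3}" and e3: "e3 \<noteq> e1" "e3 \<noteq> e2" "v \<in> e3" using e1(1) e2N by blast+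
    have "e3 \<notin> C" using e2(4) e3 by blast
    then have "7 \<le> card D" if "gcycle D" "D \<subseteq> E" "e3 \<in> D" for D
      using third_edge_cycle_length[OF e1(2,3) e2(1) _ e2(3) _ N that] e1(1) e2(2) by blast
    then have "\<not> in_k_cycle 3 e3" "\<not> in_k_cycle 5 e3"
      unfolding in_k_cycle_def k_cycle_def by fastforce+
    then have "edge_share e3 \<le> 2/7" by (rule edge_share_not_in_triangle(2))
    then have "payment e1 + payment e2 + payment e3 \<le> 0"
      using e1(1) e2N N e2(2) e3 edge_share_bound by (intro total) auto
    then show ?thesis unfolding N using e2(2) e3 by simp
  next
    case False
    obtain e1 e2 e3 where N: "?N = {e1, e2, e3}" and ne: "e1 \<noteq> e2" "e1 \<noteq> e3" "e2 \<noteq> e3"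
      using N3 unfolding card_3_iff by blast
    have "edge_share e \<le> 2/5" if "e \<in> ?N" for e
      using False that edge_share_not_in_triangle(1) by blast
    then have "payment e1 + payment e2 + payment e3 \<le> 0"
      using N ne by (intro total) auto
    then show ?thesis unfolding N using ne by simp
  qed
qed

text \<open>An edge without an end of degree 3 has value at most
  \<open>1/4 + 1/4 + 10/21 - 1 < 0\<close>. The total is thus bounded by the payments at vertices of
  degree 3, none of which has a positive sum, whereas \<open>sum_edge_value\<close> requires
  2.\<close>

lemma no_such_graph: False
proof -
  have *: "edge_value e \<le> (\<Sum>v\<in>e. if degree v = 3 then payment e else 0)" if e: "e \<in> E" for e
  proof -
    obtain u w where uw: "e = {u, w}" "u \<noteq> w" "u \<in> V" "w \<in> V" using edgeD[OF e] by blast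
    have d: "3 \<le> degree u" "3 \<le> degree w" using uw min_degree by (auto simp: degree_def)
    show ?thesis
    proof (cases "degree u = 3 \<or> degree w = 3")
      case True
      then show ?thesis using uw by (auto simp: payment_def)
    next
      case False
      then have "4 \<le> real (degree u)" "4 \<le> real (degree w)" using d by auto
      then have "1 / real (degree u) \<le> 1/4" "1 / real (degree w) \<le> 1/4"
        by (intro divide_left_mono; simp)+
      then have "edge_value e \<le> 0" using edge_share_bound[of e] uw by (simp add: edge_value_def)
      then show ?thesis using False uw by simp
    qed
  qed
  have "(\<Sum>e\<in>E. edge_value e) \<le> (\<Sum>e\<in>E. \<Sum>v\<in>e. if degree v = 3 then payment e else 0)"
    using * by (rule sum_mono)
  also have "\<dots> = (\<Sum>v\<in>V. \<Sum>e\<in>{e \<in> E. v \<in> e}. if degree v = 3 then payment e else 0)"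
    by (rule sum_incidences[symmetric])
  also have "\<dots> \<le> (\<Sum>v\<in>V. 0)"
  proof (rule sum_mono)
    fix v assume "v \<in> V"
    then show "(\<Sum>e\<in>{e \<in> E. v \<in> e}. if degree v = 3 then payment e else 0) \<le> 0"
      using payment_at_3_vertex[of v] by (cases "degree v = 3") simp_all
  qed
  finally show False using sum_edge_value by simp
qed

end

section \<open>Coloring\<close>

text \<open>
  In a \<open>DP-B\<^sub>A\<close>-coloring every vertex is added either with no neighbour to its left or,
  with a colour other than 1, as a new end of a path.
\<close>

inductive buildable :: "('a \<times> nat) pair_pre_digraph \<Rightarrow> ('a \<times> nat) set \<Rightarrow> bool" for H where
  empty: "buildable H {}"
| isolated: "buildable H T \<Longrightarrow> x \<notin> T \<Longrightarrow> neighbours H x \<inter> T = {} \<Longrightarrow> buildable H (insert x T)"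
| pendant: "buildable H T \<Longrightarrow> x \<notin> T \<Longrightarrow> snd x \<noteq> 1 \<Longrightarrow> neighbours H x \<inter> T = {y} \<Longrightarrow>
    card (neighbours H y \<inter> T) \<le> 1 \<Longrightarrow> buildable H (insert x T)"

lemma buildable_finite: "buildable H T \<Longrightarrow> finite T"
  by (induction rule: buildable.induct) auto

text \<open>The same order of construction serves for the subset; a pendant vertex whose neighbour
  is deleted becomes isolated. Recoloring a vertex starts by deleting it.\<close>

lemma buildable_subset: "buildable H T \<Longrightarrow> S \<subseteq> T \<Longrightarrow> buildable H S"
proof (induction arbitrary: S rule: buildable.induct)
  case empty
  then show ?case by (simp add: buildable.empty)
next
  case (isolated T x)
  show ?case
  proof (cases "x \<in> S")
    case True
    have "S - {x} \<subseteq> T" using isolated.prems by blast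
    moreover have "neighbours H x \<inter> (S - {x}) = {}" using isolated calculation by blast
    ultimately have "buildable H (insert x (S - {x}))" using isolated.IH by (intro buildable.isolated) auto
    then show ?thesis using True by (simp add: insert_absorb)
  qed (use isolated in blast)
next
  case (pendant T x y)
  show ?case
  proof (cases "x \<in> S")
    case True
    have sub: "S - {x} \<subseteq> T" using pendant.prems by blast
    have fin: "finite T" using pendant.hyps(1) by (rule buildable_finite)
    have "buildable H (insert x (S - {x}))"
    proof (cases "y \<in> S - {x}")
      case True
      have "card (neighbours H y \<inter> (S - {x})) \<le> card (neighbours H y \<inter> T)"
        using sub fin by (intro card_mono) auto
      then show ?thesis
        using True sub pendant by (intro buildable.pendant[where y = y]) auto
    next
      case False
      have "neighbours H x \<inter> (S - {x}) \<subseteq> {y}" using sub pendant.hyps(4) by (metis inf_mono order_refl)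
      then have "neighbours H x \<inter> (S - {x}) = {}" using False by auto
      then show ?thesis using pendant.IH[OF sub] by (intro buildable.isolated) simp_all
    qed
    then show ?thesis using True by (simp add: insert_absorb)
  qed (use pendant in blast)
qed

text \<open>A new vertex goes to the right end, where everything built so far lies to its left and
  the earlier vertices notice no change. The order of construction therefore becomes the order of
  the coloring.\<close>

lemma linear_order_on_insert_top:
  assumes r: "linear_order_on T r" and x: "x \<notin> T"
  defines "r' \<equiv> r \<union> insert x T \<times> {x}"
  shows "linear_order_on (insert x T) r'" and "left_of (insert x T) r' x = T"
    and "z \<in> T \<Longrightarrow> left_of (insert x T) r' z = left_of T r z"
proof -
  have sub: "r \<subseteq> T \<times> T"
    using r unfolding linear_order_on_def partial_order_on_def preorder_on_def refl_on_def by blast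
  have R: "refl_on T r" "trans r" "antisym r" "total_on T r"
    using r unfolding linear_order_on_def partial_order_on_def preorder_on_def by auto
  have "refl_on (insert x T) r'"
    using R(1) sub unfolding r'_def refl_on_def by blast
  moreover have "r' \<subseteq> insert x T \<times> insert x T" using sub unfolding r'_def by blast
  moreover have "trans r'"
    using R(2) sub x unfolding r'_def trans_def by blast
  moreover have "antisym r'"
    using R(3) sub x unfolding r'_def antisym_def by blast
  moreover have "total_on (insert x T) r'"
    using R(4) unfolding r'_def total_on_def by blast
  ultimately show "linear_order_on (insert x T) r'"
    unfolding linear_order_on_def partial_order_on_def preorder_on_def by blast
  show "left_of (insert x T) r' x = T" using sub x unfolding left_of_def r'_def by blast
  show "z \<in> T \<Longrightarrow> left_of (insert x T) r' z = left_of T r z"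
    using sub x unfolding left_of_def r'_def by blast
qed

lemma buildable_imp_coloring: "buildable H T \<Longrightarrow> DP_BA_coloring H T"
proof (induction rule: buildable.induct)
  case empty
  have "linear_order_on {} {}" by (simp add: linear_order_on_def partial_order_on_def preorder_on_def)
  then show ?case unfolding DP_BA_coloring_def by (intro exI[of _ "{}"]) auto
next
  case (isolated T x)
  then obtain r where r: "linear_order_on T r"
    "\<And>v. (v, 1) \<in> T \<Longrightarrow> neighbours H (v, 1) \<inter> left_of T r (v, 1) = {}"
    "\<And>v c. (v, c) \<in> T \<Longrightarrow> c \<noteq> 1 \<Longrightarrow> card (neighbours H (v, c) \<inter> left_of T r (v, c)) \<le> 1 \<and>
      (\<forall>y \<in> neighbours H (v, c) \<inter> left_of T r (v, c). card (neighbours H y \<inter> left_of T r (v, c)) \<le> 1)"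
    unfolding DP_BA_coloring_def by blast
  note L = linear_order_on_insert_top[OF r(1) isolated.hyps(2)]
  show ?case
    unfolding DP_BA_coloring_def
  proof (intro exI conjI allI impI)
    show "linear_order_on (insert x T) (r \<union> insert x T \<times> {x})" by (rule L)
  next
    fix v assume "(v, 1) \<in> insert x T"
    then show "neighbours H (v, 1) \<inter> left_of (insert x T) (r \<union> insert x T \<times> {x}) (v, 1) = {}"
      using L(2,3) r(2) isolated.hyps by (cases "(v, 1) = x") auto
  next
    fix v c assume "(v, c) \<in> insert x T \<and> c \<noteq> 1"
    then have vc: "(v, c) = x \<or> (v, c) \<in> T" "c \<noteq> 1" by auto
    let ?L = "left_of (insert x T) (r \<union> insert x T \<times> {x}) (v, c)"
    have *: "card (neighbours H (v, c) \<inter> ?L) \<le> 1 \<and>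
      (\<forall>y \<in> neighbours H (v, c) \<inter> ?L. card (neighbours H y \<inter> ?L) \<le> 1)"
    proof (cases "(v, c) \<in> T")
      case True
      then show ?thesis using L(3)[OF True] r(3)[OF True vc(2)] by simp
    next
      case False
      then have "(v, c) = x" using vc(1) by simp
      then show ?thesis using L(2) isolated.hyps by simp
    qed
    show "card (neighbours H (v, c) \<inter> ?L) \<le> 1" using * by blast
    show "\<forall>y \<in> neighbours H (v, c) \<inter> ?L. card (neighbours H y \<inter> ?L) \<le> 1" using * by blast
  qed
next
  case (pendant T x w)
  then obtain r where r: "linear_order_on T r"
    "\<And>v. (v, 1) \<in> T \<Longrightarrow> neighbours H (v, 1) \<inter> left_of T r (v, 1) = {}"
    "\<And>v c. (v, c) \<in> T \<Longrightarrow> c \<noteq> 1 \<Longrightarrow> card (neighbours H (v, c) \<inter> left_of T r (v, c)) \<le> 1 \<and>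
      (\<forall>y \<in> neighbours H (v, c) \<inter> left_of T r (v, c). card (neighbours H y \<inter> left_of T r (v, c)) \<le> 1)"
    unfolding DP_BA_coloring_def by blast
  note L = linear_order_on_insert_top[OF r(1) pendant.hyps(2)]
  show ?case
    unfolding DP_BA_coloring_def
  proof (intro exI conjI allI impI)
    show "linear_order_on (insert x T) (r \<union> insert x T \<times> {x})" by (rule L)
  next
    fix v assume "(v, 1) \<in> insert x T"
    then have "(v, 1) \<in> T" using pendant.hyps(3) by auto
    then show "neighbours H (v, 1) \<inter> left_of (insert x T) (r \<union> insert x T \<times> {x}) (v, 1) = {}"
      using L(3) r(2) by simp
  next
    fix v c assume "(v, c) \<in> insert x T \<and> c \<noteq> 1"
    then have vc: "(v, c) = x \<or> (v, c) \<in> T" "c \<noteq> 1" by auto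
    let ?L = "left_of (insert x T) (r \<union> insert x T \<times> {x}) (v, c)"
    have *: "card (neighbours H (v, c) \<inter> ?L) \<le> 1 \<and>
      (\<forall>y \<in> neighbours H (v, c) \<inter> ?L. card (neighbours H y \<inter> ?L) \<le> 1)"
    proof (cases "(v, c) \<in> T")
      case True
      then show ?thesis using L(3)[OF True] r(3)[OF True vc(2)] by simp
    next
      case False
      then have "(v, c) = x" using vc(1) by simp
      then show ?thesis using L(2) pendant.hyps by simp
    qed
    show "card (neighbours H (v, c) \<inter> ?L) \<le> 1" using * by blast
    show "\<forall>y \<in> neighbours H (v, c) \<inter> ?L. card (neighbours H y \<inter> ?L) \<le> 1" using * by blast
  qed
qed

section \<open>Partial colorings of a cover and their extension\<close>

locale three_cover =
  fixes G :: "'a pair_pre_digraph" and L :: "'a \<Rightarrow> nat set" and H :: "('a \<times> nat) pair_pre_digraph"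
  assumes G: "pair_graph G" and L: "assignment 3 G L" and H: "cover G L H"
begin

sublocale G: pair_graph G by (rule G)

sublocale H: pair_graph H by (rule pair_graph_cover[OF G L H])

lemma list_eq: "u \<in> pverts G \<Longrightarrow> L u = {1, 2, 3}"
proof -
  assume "u \<in> pverts G"
  then have "L u \<subseteq> {1..3}" "card (L u) = card {1..3::nat}" using L by (auto simp: assignment_def)
  then have "L u = {1..3}" by (intro card_subset_eq) auto
  also have "{1..3} = {1, 2, 3::nat}" by auto
  finally show ?thesis .
qed

lemma arc_proj: "(x, y) \<in> parcs H \<Longrightarrow> (fst x, fst y) \<in> parcs G"
  using H unfolding cover_def matching_between_def by fastforce

lemma neighbours_sym: "y \<in> neighbours H x \<longleftrightarrow> x \<in> neighbours H y"
  unfolding neighbours_def mem_Collect_eq using H.arcs_symmetric by blast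

lemma neighbour_proj: "y \<in> neighbours H x \<Longrightarrow> (fst x, fst y) \<in> parcs G"
  using arc_proj by (simp add: neighbours_def)

lemma neighbour_unique:
  assumes "y \<in> neighbours H x" "y' \<in> neighbours H x" "fst y = fst y'"
  shows "y = y'"
proof -
  obtain M where M: "\<forall>(u, v) \<in> parcs G.
       matching_between ({u} \<times> L u) ({v} \<times> L v) (M u v) \<and> M v u = (M u v)\<inverse>"
     "parcs H = (\<Union>(u, v) \<in> parcs G. M u v)" using H unfolding cover_def by blast
  have *: "\<exists>u v. (u, v) \<in> parcs G \<and> (x, z) \<in> M u v \<and> u = fst x \<and> v = fst z" if z: "z \<in> neighbours H x" for z
  proof -
    obtain u v where uv: "(u, v) \<in> parcs G" "(x, z) \<in> M u v" using z M(2) by (auto simp: neighbours_def)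
    then have "M u v \<subseteq> ({u} \<times> L u) \<times> ({v} \<times> L v)" using M(1) by (fastforce simp: matching_between_def)
    then show ?thesis using uv by fastforce
  qed
  have "(x, y) \<in> M (fst x) (fst y)" "(x, y') \<in> M (fst x) (fst y)" "(fst x, fst y) \<in> parcs G"
    using *[OF assms(1)] *[OF assms(2)] assms(3) by auto
  then show ?thesis using M(1) by (fastforce simp: matching_between_def dest: single_valuedD)
qed

lemma not_self_neighbour: "x \<notin> neighbours H x"
  using neighbour_proj G.no_loops' by blast

lemma finite_neighbours: "finite (neighbours H x)"
proof -
  have "neighbours H x \<subseteq> snd ` parcs H" by (force simp: neighbours_def)
  then show ?thesis using H.pair_finite_arcs finite_surj by blast
qed

definition nb :: "'a set \<Rightarrow> 'a \<Rightarrow> 'a set" where "nb W v = {u \<in> W. (v, u) \<in> parcs G}"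

definition col :: "'a set \<Rightarrow> ('a \<times> nat) set \<Rightarrow> bool" where
  "col W T \<longleftrightarrow> buildable H T \<and> inj_on fst T \<and> fst ` T = W \<and> snd ` T \<subseteq> {1, 2, 3}"

definition hits :: "('a \<times> nat) set \<Rightarrow> 'a \<Rightarrow> nat \<Rightarrow> ('a \<times> nat) set" where
  "hits T v c = neighbours H (v, c) \<inter> T"

lemma finite_hits [simp]: "finite (hits T v c)"
  unfolding hits_def using finite_neighbours by simp

lemma finite_nb: "W \<subseteq> pverts G \<Longrightarrow> finite (nb W v)"
  unfolding nb_def using G.pair_finite_verts finite_subset by fastforce

text \<open>A coloured neighbour is matched to at most one copy of \<open>v\<close>, so it blocks at
  most one colour. All pigeonhole arguments below rest on this.\<close>

lemma hits_disjoint: "c \<noteq> c' \<Longrightarrow> hits T v c \<inter> hits T v c' = {}"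
  unfolding hits_def using neighbours_sym neighbour_unique[of "(v, c)" _ "(v, c')"] by auto

lemma hits_image: "col W T \<Longrightarrow> fst ` hits T v c \<subseteq> nb W v"
proof
  assume T: "col W T"
  fix u assume "u \<in> fst ` hits T v c"
  then obtain z where "u = fst z" "z \<in> neighbours H (v, c)" "z \<in> T" unfolding hits_def by blast
  then show "u \<in> nb W v" using neighbour_proj[of z "(v, c)"] T by (auto simp: nb_def col_def)
qed

text \<open>In the case of equality every neighbour blocks some colour; this locates
  \<open>w\<close> in \<open>extend_adjacent_3_vertices\<close>.\<close>

lemma sum_hits:
  assumes "col W T" "W \<subseteq> pverts G"
  shows "card (hits T v 1) + card (hits T v 2) + card (hits T v 3) \<le> card (nb W v)"
    and "card (hits T v 1) + card (hits T v 2) + card (hits T v 3) = card (nb W v) \<Longrightarrow>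
      fst ` (hits T v 1 \<union> hits T v 2 \<union> hits T v 3) = nb W v"
proof -
  let ?U = "hits T v 1 \<union> hits T v 2 \<union> hits T v 3"
  have "card ?U = card (hits T v 1) + card (hits T v 2) + card (hits T v 3)"
    using hits_disjoint[of 1 2 T v] hits_disjoint[of 1 3 T v] hits_disjoint[of 2 3 T v]
    by (simp add: card_Un_disjoint Int_Un_distrib2)
  moreover have "inj_on fst ?U"
    using assms(1) unfolding col_def hits_def by (meson Un_subset_iff inf_le2 inj_on_subset)
  moreover have img: "fst ` ?U \<subseteq> nb W v" using hits_image[OF assms(1)] by blast
  ultimately have eq: "card (fst ` ?U) = card (hits T v 1) + card (hits T v 2) + card (hits T v 3)"
    by (simp add: card_image)
  then show "card (hits T v 1) + card (hits T v 2) + card (hits T v 3) \<le> card (nb W v)"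
    using card_mono[OF finite_nb[OF assms(2)] img] by simp
  show "fst ` ?U = nb W v" if "card (hits T v 1) + card (hits T v 2) + card (hits T v 3) = card (nb W v)"
    using card_subset_eq[OF finite_nb[OF assms(2)] img] eq that by simp
qed

lemma free_colour:
  assumes "col W T" "W \<subseteq> pverts G" "card (nb W v) \<le> 2"
  shows "\<exists>c\<in>{1, 2, 3}. hits T v c = {}"
proof (rule ccontr)
  assume "\<not> ?thesis"
  then have "1 \<le> card (hits T v 1)" "1 \<le> card (hits T v 2)" "1 \<le> card (hits T v 3)"
    by (auto simp: Suc_le_eq card_gt_0_iff)
  then show False using sum_hits(1)[OF assms(1,2), of v] assms(3) by linarith
qed

lemma col_insert:
  assumes "col W T" "v \<notin> W" "c \<in> {1, 2, 3}" "buildable H (insert (v, c) T)"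
  shows "col (insert v W) (insert (v, c) T)"
  using assms unfolding col_def by (auto simp: inj_on_insert)

lemma notin_col: "col W T \<Longrightarrow> v \<notin> W \<Longrightarrow> (v, c) \<notin> T"
  unfolding col_def by force

lemma col_insert_isolated:
  assumes "col W T" "v \<notin> W" "c \<in> {1, 2, 3}" "hits T v c = {}"
  shows "col (insert v W) (insert (v, c) T)"
proof (rule col_insert[OF assms(1-3)])
  show "buildable H (insert (v, c) T)"
    using assms notin_col[OF assms(1,2)] by (intro buildable.isolated) (auto simp: col_def hits_def)
qed

lemma col_insert_pendant:
  assumes "col W T" "v \<notin> W" "c \<in> {2, 3}" "hits T v c = {y}" "card (neighbours H y \<inter> T) \<le> 1"
  shows "col (insert v W) (insert (v, c) T)"
proof (rule col_insert[OF assms(1,2)])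
  show "buildable H (insert (v, c) T)"
    using assms notin_col[OF assms(1,2)] by (intro buildable.pendant[where y = y]) (auto simp: col_def hits_def)
qed (use assms in auto)

lemma extend_degree_2:
  assumes "col W T" "W \<subseteq> pverts G" "v \<notin> W" "card (nb W v) \<le> 2"
  shows "\<exists>T'. col (insert v W) T'"
  using free_colour[OF assms(1,2,4)] col_insert_isolated[OF assms(1,3)] by blast

text \<open>A coloring with fewest cover edges: otherwise \<open>w\<close> could be recoloured so as to become isolated.\<close>

lemma col_few_neighbours:
  assumes "col W T0" "W \<subseteq> pverts G"
  shows "\<exists>T. col W T \<and> (\<forall>x\<in>T. card (nb W (fst x)) \<le> 3 \<longrightarrow> card (neighbours H x \<inter> T) \<le> 1)"
proof -
  define m where "m T = card (parcs H \<inter> T \<times> T)" for T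
  obtain T where T: "col W T" "\<And>T'. col W T' \<Longrightarrow> m T \<le> m T'"
    using ex_has_least_nat[of "col W" T0 m] assms(1) by blast
  have "card (neighbours H x \<inter> T) \<le> 1" if x: "x \<in> T" and deg: "card (nb W (fst x)) \<le> 3" for x
  proof (rule ccontr)
    assume two: "\<not> card (neighbours H x \<inter> T) \<le> 1"
    obtain w c0 where wc: "x = (w, c0)" by (cases x)
    have c0: "c0 \<in> {1, 2, 3}" using T(1) x wc unfolding col_def by force
    have h2: "2 \<le> card (hits T w c0)" using two wc by (simp add: hits_def)
    \<comment> \<open>Among at most three coloured neighbours, at least two hit \<open>c0\<close>,
      so at most one is left for the other two colours.\<close>
    have "\<exists>c\<in>{1, 2, 3} - {c0}. hits T w c = {}"
    proof (rule ccontr)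
      assume "\<not> ?thesis"
      then have ne: "1 \<le> card (hits T w c)" if "c \<in> {1, 2, 3} - {c0}" for c
        using that by (simp add: Suc_le_eq card_gt_0_iff)
      have "4 \<le> card (hits T w 1) + card (hits T w 2) + card (hits T w 3)"
        using h2 c0 ne[of 1] ne[of 2] ne[of 3] by auto
      then show False using sum_hits(1)[OF T(1) assms(2), of w] deg wc by simp
    qed
    then obtain c where c: "c \<in> {1, 2, 3}" "c \<noteq> c0" "hits T w c = {}" by blast
    let ?S = "T - {x}"
    have S: "col (W - {w}) ?S"
    proof -
      have "fst ` ?S = W - {w}"
        using T(1) x wc inj_on_image_set_diff[of fst T T "{x}"] unfolding col_def by auto
      moreover have "buildable H ?S" using T(1) buildable_subset unfolding col_def by blast
      ultimately show ?thesis using T(1) unfolding col_def by (auto intro: inj_on_subset)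
    qed
    have "hits ?S w c = {}" using c(3) by (auto simp: hits_def)
    then have "col (insert w (W - {w})) (insert (w, c) ?S)"
      by (intro col_insert_isolated[OF S _ c(1)]) simp_all
    moreover have "w \<in> W" using T(1) x wc unfolding col_def by force
    ultimately have col': "col W (insert (w, c) ?S)" by (simp only: insert_Diff)
    have "hits T w c0 \<noteq> {}" using h2 by auto
    then obtain y where y: "y \<in> hits T w c0" by blast
    \<comment> \<open>The copy \<open>(w, c)\<close> is isolated and adds no cover edge, while the
      edge between \<open>x\<close> and \<open>y\<close> is lost, against minimality.\<close>
    have "parcs H \<inter> insert (w, c) ?S \<times> insert (w, c) ?S \<subset> parcs H \<inter> T \<times> T"
    proof
      show "parcs H \<inter> insert (w, c) ?S \<times> insert (w, c) ?S \<subseteq> parcs H \<inter> T \<times> T"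
        using c(3) not_self_neighbour[of "(w, c)"] neighbours_sym[of _ "(w, c)"]
        unfolding hits_def neighbours_def by blast
      have "(x, y) \<in> parcs H \<inter> T \<times> T" using y x wc by (auto simp: hits_def neighbours_def)
      moreover have "x \<notin> insert (w, c) ?S" using c(2) wc by auto
      ultimately show "parcs H \<inter> insert (w, c) ?S \<times> insert (w, c) ?S \<noteq> parcs H \<inter> T \<times> T" by blast
    qed
    then have "m (insert (w, c) ?S) < m T"
      unfolding m_def using H.pair_finite_arcs by (intro psubset_card_mono) auto
    then show False using T(2)[OF col'] by simp
  qed
  then show ?thesis using T(1) by blast
qed

text \<open>With two coloured neighbours each, \<open>u\<close> and \<open>v\<close> have free
  colours. Both copies can be added if they are not adjacent or if one of them has a colour other
  than 1, which is then added last. There remain adjacent copies of colour 1. By the matching,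
  \<open>(v, 1)\<close> is adjacent to no other copy of \<open>u\<close>, so \<open>u\<close> may
  use 2 or 3 instead. If both are hit, each is hit once and one of them by the copy of
  \<open>w\<close>, which has at most one neighbour and so accepts \<open>u\<close> as a new end of
  its path.\<close>

lemma extend_adjacent_3_vertices:
  assumes T0: "col W T0" and W: "W \<subseteq> pverts G" and uv: "(u, v) \<in> parcs G" "u \<notin> W" "v \<notin> W"
    and deg: "card (nb W u) = 2" "card (nb W v) = 2" and w: "w \<in> nb W u" "card (nb W w) \<le> 3"
  shows "\<exists>T'. col (insert u (insert v W)) T'"
proof -
  obtain T where T: "col W T" and few: "\<And>x. x \<in> T \<Longrightarrow> card (nb W (fst x)) \<le> 3 \<Longrightarrow> card (neighbours H x \<inter> T) \<le> 1"
    using col_few_neighbours[OF T0 W] by blast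
  have "u \<noteq> v" using uv(1) by (rule G.no_loops')
  obtain cu where cu: "cu \<in> {1, 2, 3}" "hits T u cu = {}" using free_colour[OF T W eq_imp_le[OF deg(1)]] by blast
  obtain cv where cv: "cv \<in> {1, 2, 3}" "hits T v cv = {}" using free_colour[OF T W eq_imp_le[OF deg(2)]] by blast
  have colv: "col (insert v W) (insert (v, cv) T)" if "cv \<in> {1, 2, 3}" "hits T v cv = {}" for cv
    using col_insert_isolated[OF T uv(3) that] .
  have unv: "u \<notin> insert v W" "v \<notin> insert u W" using uv \<open>u \<noteq> v\<close> by auto
  show ?thesis
  proof (cases "(v, cv) \<in> neighbours H (u, cu)")
    case False
    then have "hits (insert (v, cv) T) u cu = {}" using cu by (auto simp: hits_def)
    then show ?thesis using col_insert_isolated[OF colv[OF cv] unv(1) cu(1)] by blast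
  next
    case adj: True
    consider "cu \<noteq> 1" | "cv \<noteq> 1" | "cu = 1" "cv = 1" by blast
    then show ?thesis
    proof cases
      case 1
      have "hits (insert (v, cv) T) u cu = {(v, cv)}" using cu(2) adj by (auto simp: hits_def)
      moreover have "neighbours H (v, cv) \<inter> insert (v, cv) T = {}"
        using cv(2) not_self_neighbour[of "(v, cv)"] by (auto simp: hits_def)
      ultimately show ?thesis
        using col_insert_pendant[OF colv[OF cv] unv(1), of cu "(v, cv)"] cu(1) 1 by auto
    next
      case 2
      have adj': "(u, cu) \<in> neighbours H (v, cv)" using adj neighbours_sym by blast
      have "hits (insert (u, cu) T) v cv = {(u, cu)}" using cv(2) adj' by (auto simp: hits_def)
      moreover have "neighbours H (u, cu) \<inter> insert (u, cu) T = {}"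
        using cu(2) not_self_neighbour[of "(u, cu)"] by (auto simp: hits_def)
      ultimately have "col (insert v (insert u W)) (insert (v, cv) (insert (u, cu) T))"
        using col_insert_pendant[OF col_insert_isolated[OF T uv(2) cu] unv(2), of cv "(u, cu)"] cv(1) 2 by auto
      then show ?thesis by (metis insert_commute)
    next
      case 3
      show ?thesis
      proof (cases "hits T u 2 = {} \<or> hits T u 3 = {}")
        case True
        then obtain c where c: "c \<in> {2, 3}" "hits T u c = {}" by blast
        have "(v, cv) \<notin> neighbours H (u, c)"
        proof
          assume "(v, cv) \<in> neighbours H (u, c)"
          then have "(u, c) = (u, cu)"
            using adj neighbours_sym by (intro neighbour_unique[of _ "(v, cv)"]) auto
          then show False using c 3 by auto
        qed
        then have "hits (insert (v, cv) T) u c = {}" using c(2) by (auto simp: hits_def)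
        then show ?thesis using col_insert_isolated[OF colv[OF cv] unv(1), of c] c(1) by auto
      next
        case False
        have ge: "1 \<le> card (hits T u 2)" "1 \<le> card (hits T u 3)"
          using False by (auto simp: Suc_le_eq card_gt_0_iff)
        have h1: "card (hits T u 1) = 0" using cu(2) 3(1) by simp
        have sum: "card (hits T u 1) + card (hits T u 2) + card (hits T u 3) = card (nb W u)"
          and one: "card (hits T u 2) = 1" "card (hits T u 3) = 1"
          using ge h1 sum_hits(1)[OF T W, of u] deg(1) by linarith+
        have "w \<in> fst ` (hits T u 1 \<union> hits T u 2 \<union> hits T u 3)"
          using sum_hits(2)[OF T W sum] w(1) by simp
        then obtain z c where z: "c \<in> {2, 3}" "z \<in> hits T u c" "fst z = w"
          using cu(2) 3(1) by auto
        have "card (hits T u c) = 1" using z(1) one by auto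
        then have hc: "hits T u c = {z}" using z(2) by (auto simp: card_1_singleton_iff)
        have "(v, cv) \<notin> neighbours H (u, c)"
        proof
          assume "(v, cv) \<in> neighbours H (u, c)"
          then have "(u, c) = (u, cu)"
            using adj neighbours_sym by (intro neighbour_unique[of _ "(v, cv)"]) auto
          then show False using z(1) 3 by auto
        qed
        then have 1: "hits (insert (v, cv) T) u c = {z}" using hc by (auto simp: hits_def)
        have zT: "z \<in> T" using z(2) by (auto simp: hits_def)
        have "(v, cv) \<notin> neighbours H z"
          using cv(2) zT neighbours_sym by (auto simp: hits_def)
        then have "neighbours H z \<inter> insert (v, cv) T = neighbours H z \<inter> T" by auto
        then have "card (neighbours H z \<inter> insert (v, cv) T) \<le> 1"
          using few[OF zT] z(3) w(2) by simp
        then show ?thesis using col_insert_pendant[OF colv[OF cv] unv(1) z(1) 1] by blast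
      qed
    qed
  qed
qed

end

section \<open>Cyclic edge sets as cycles of the digraph\<close>

fun arcs_of_path :: "'a list \<Rightarrow> ('a \<times> 'a) list" where
  "arcs_of_path (x # y # zs) = (x, y) # arcs_of_path (y # zs)"
| "arcs_of_path _ = []"

lemma arcs_of_path:
  "xs \<noteq> [] \<Longrightarrow> pcas (hd xs) (arcs_of_path xs) (last xs)"
  "xs \<noteq> [] \<Longrightarrow> pawalk_verts (hd xs) (arcs_of_path xs) = xs"
  "length (arcs_of_path xs) = length xs - 1"
  "(x, y) \<in> set (arcs_of_path xs) \<Longrightarrow> {x, y} \<in> pedges xs"
  by (induction xs rule: arcs_of_path.induct) auto

lemma has_cycle_of_gcycle:
  assumes "pair_graph G" "gcycle C" and C: "\<And>x y. {x, y} \<in> C \<Longrightarrow> (x, y) \<in> parcs G"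
  shows "has_cycle_of_length G (card C)"
proof -
  interpret pair_graph G by fact
  obtain xs where xs: "3 \<le> length xs" "distinct xs" "C = insert {last xs, hd xs} (pedges xs)"
    using assms(2) by (auto simp: gcycle_def)
  have ne: "xs \<noteq> []" using xs(1) by auto
  let ?p = "(last xs, hd xs) # arcs_of_path xs"
  have arc: "(last xs, hd xs) \<in> parcs G" using C xs(3) by simp
  have "awalk (last xs) ?p (last xs)"
    unfolding awalk_def using arcs_of_path(1)[OF ne] arcs_of_path(4)[of _ _ xs] arc in_arcsD1[OF arc] C xs(3) by auto
  moreover have "distinct (tl (pawalk_verts (last xs) ?p))"
    using arcs_of_path(2)[OF ne] xs(2) by simp
  ultimately have "cycle ?p" unfolding cycle_def by blast
  moreover have "length ?p = card C"
    using arcs_of_path(3)[of xs] gcycle_card[OF xs(2,1)] xs by (simp add: insert_commute)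
  ultimately show ?thesis unfolding has_cycle_of_length_def by blast
qed

section \<open>Reducible configurations and the induction\<close>

locale planar_three_cover = three_cover +
  assumes planar: "planar G"
    and no_4: "\<not> has_cycle_of_length G 4" and no_6: "\<not> has_cycle_of_length G 6"
begin

definition induced_edges :: "'a set \<Rightarrow> 'a set set" where
  "induced_edges W = {{u, v} |u v. u \<in> W \<and> v \<in> W \<and> (u, v) \<in> parcs G}"

lemma induced_edges_iff: "{u, v} \<in> induced_edges W \<longleftrightarrow> u \<in> W \<and> v \<in> W \<and> (u, v) \<in> parcs G"
  unfolding induced_edges_def using G.arcs_symmetric by (auto simp: doubleton_eq_iff)

lemma card_induced_edges_at:
  assumes "v \<in> W" shows "card {e \<in> induced_edges W. v \<in> e} = card (nb W v)"
proof -
  have "{e \<in> induced_edges W. v \<in> e} = (\<lambda>u. {v, u}) ` nb W v"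
    using assms G.arcs_symmetric unfolding induced_edges_def nb_def by (auto simp: insert_commute)
  moreover have "inj_on (\<lambda>u. {v, u}) (nb W v)" by (auto simp: inj_on_def doubleton_eq_iff)
  ultimately show ?thesis by (simp add: card_image)
qed

text \<open>Degrees are those in the subgraph induced by \<open>W\<close>, which inherits the
  drawing and the absence of 4- and 6-cycles. Without a configuration it would be an instance of the
  contradictory locale \<open>plane_graph_no_4_6\<close>.\<close>

lemma reducible_configuration:
  assumes W: "W \<subseteq> pverts G" "W \<noteq> {}"
  shows "(\<exists>v\<in>W. card (nb W v) \<le> 2) \<or>
    (\<exists>u\<in>W. \<exists>v\<in>nb W u. \<exists>w\<in>nb W u. w \<noteq> v \<and> card (nb W u) = 3 \<and> card (nb W v) = 3 \<and> card (nb W w) \<le> 4)"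
proof (rule ccontr)
  assume no: "\<not> ?thesis"
  obtain \<phi> \<gamma> where d: "plane_drawing G \<phi> \<gamma>" using planar by (auto simp: planar_def)
  have dv: "w = u \<or> w = v"
    if "(u, v) \<in> parcs G" "w \<in> pverts G" "\<phi> w \<in> path_image (\<gamma> (u, v))" for u v w
    using d that unfolding plane_drawing_def by fast
  have dx: "path_image (\<gamma> (u, v)) \<inter> path_image (\<gamma> (x, y)) \<subseteq> \<phi> ` ({u, v} \<inter> {x, y})"
    if "(u, v) \<in> parcs G" "(x, y) \<in> parcs G" "{u, v} \<noteq> {x, y}" for u v x y
    using conjunct2[OF conjunct2[OF conjunct2[OF d[unfolded plane_drawing_def]]]] that by fast
  \<comment> \<open>The union over both orientations avoids choosing one; the two curves have the
    same image.\<close>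
  define I where "I e = (\<Union>a \<in> {a \<in> parcs G. {fst a, snd a} = e}. path_image (\<gamma> a))" for e
  let ?E = "induced_edges W"
  have rev: "path_image (\<gamma> (v, u)) = path_image (\<gamma> (u, v))" if "(u, v) \<in> parcs G" for u v
  proof -
    have "\<gamma> (v, u) = reversepath (\<gamma> (u, v))" using d that by (auto simp: plane_drawing_def)
    then show ?thesis by simp
  qed
  have I: "I {u, v} = path_image (\<gamma> (u, v))" if uv: "(u, v) \<in> parcs G" for u v
  proof -
    have "{a \<in> parcs G. {fst a, snd a} = {u, v}} = {(u, v), (v, u)}"
      using uv G.arcs_symmetric[OF uv] by (auto simp: doubleton_eq_iff)
    then show ?thesis using rev[OF uv] by (simp add: I_def)
  qed
  have ex: "\<exists>u v. e = {u, v} \<and> u \<in> W \<and> v \<in> W \<and> (u, v) \<in> parcs G" if "e \<in> ?E" for e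
    using that by (auto simp: induced_edges_def)
  interpret plane_graph_no_4_6 W ?E \<phi> I
  proof
    show "finite W" using W(1) G.pair_finite_verts finite_subset by blast
    show "\<exists>u v. e = {u, v} \<and> u \<noteq> v \<and> u \<in> W \<and> v \<in> W" if "e \<in> ?E" for e
      using ex[OF that] G.no_loops' by metis
    show "inj_on \<phi> W" using d W(1) inj_on_subset by (auto simp: plane_drawing_def)
    show "\<exists>g. arc g \<and> pathstart g = \<phi> u \<and> pathfinish g = \<phi> v \<and> path_image g = I {u, v}"
      if "{u, v} \<in> ?E" for u v
    proof -
      have uv: "(u, v) \<in> parcs G" using that by (simp add: induced_edges_iff)
      then show ?thesis using d I[OF uv] by (intro exI[of _ "\<gamma> (u, v)"]) (auto simp: plane_drawing_def)
    qed
    show "w \<in> e" if "e \<in> ?E" "w \<in> W" "\<phi> w \<in> I e" for e w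
    proof -
      obtain u v where uv: "e = {u, v}" "(u, v) \<in> parcs G" using ex[OF \<open>e \<in> ?E\<close>] by blast
      then have "\<phi> w \<in> path_image (\<gamma> (u, v))" using that(3) I by simp
      moreover have "w \<in> pverts G" using that(2) W(1) by blast
      ultimately show ?thesis using dv[OF uv(2)] uv(1) by auto
    qed
    show "I e \<inter> I e' \<subseteq> \<phi> ` (e \<inter> e')" if "e \<in> ?E" "e' \<in> ?E" "e \<noteq> e'" for e e'
    proof -
      obtain u v where uv: "e = {u, v}" "(u, v) \<in> parcs G" using ex[OF \<open>e \<in> ?E\<close>] by blast
      obtain x y where xy: "e' = {x, y}" "(x, y) \<in> parcs G" using ex[OF \<open>e' \<in> ?E\<close>] by blast
      have "path_image (\<gamma> (u, v)) \<inter> path_image (\<gamma> (x, y)) \<subseteq> \<phi> ` ({u, v} \<inter> {x, y})"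
        using dx[OF uv(2) xy(2)] \<open>e \<noteq> e'\<close> uv(1) xy(1) by simp
      then show ?thesis using I uv xy by simp
    qed
    show "card C \<noteq> 4 \<and> card C \<noteq> 6" if "gcycle C" "C \<subseteq> ?E" for C
    proof -
      have "(x, y) \<in> parcs G" if "{x, y} \<in> C" for x y
        using subsetD[OF \<open>C \<subseteq> ?E\<close> that] by (simp add: induced_edges_iff)
      then have "has_cycle_of_length G (card C)"
        by (rule has_cycle_of_gcycle[OF G \<open>gcycle C\<close>])
      then show ?thesis using no_4 no_6 by metis
    qed
    show "3 \<le> card {e \<in> ?E. v \<in> e}" if "v \<in> W" for v
      using no that by (auto simp: card_induced_edges_at not_le)
    show "W \<noteq> {}" by fact
    show "5 \<le> card {e \<in> ?E. w \<in> e}"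
      if "{u, v} \<in> ?E" "u \<noteq> v" "card {e \<in> ?E. u \<in> e} = 3" "card {e \<in> ?E. v \<in> e} = 3" "{u, w} \<in> ?E" "w \<noteq> v" for u v w
    proof -
      have "u \<in> W" "v \<in> W" "w \<in> W" "v \<in> nb W u" "w \<in> nb W u"
        using that by (auto simp: induced_edges_iff nb_def)
      then show ?thesis using no that by (force simp: card_induced_edges_at not_le)
    qed
  qed
  show False by (rule no_such_graph)
qed

lemma nb_remove: "card (nb W v) = Suc (card (nb (W - {x}) v))" if "x \<in> nb W v" "W \<subseteq> pverts G"
proof -
  have "nb (W - {x}) v = nb W v - {x}" by (auto simp: nb_def)
  then show ?thesis using card.remove[OF finite_nb[OF that(2)] that(1)] by simp
qed

lemma nb_irrefl: "v \<notin> nb W v"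
  unfolding nb_def using G.no_loops' by blast

lemma nb_sym: "u \<in> W \<Longrightarrow> v \<in> nb W u \<Longrightarrow> u \<in> nb W v"
  unfolding nb_def using G.arcs_symmetric by auto

text \<open>Strong induction over all vertex subsets replaces the minimal counterexample. Deleting
  \<open>u\<close> lowers the degree of its neighbour \<open>w\<close> from at most 4 to at most 3,
  the bound under which \<open>w\<close> can be recolored.\<close>

lemma col_exists: "W \<subseteq> pverts G \<Longrightarrow> \<exists>T. col W T"
proof (induction "card W" arbitrary: W rule: less_induct)
  case less
  have finW: "finite W" using less.prems G.pair_finite_verts finite_subset by blast
  show ?case
  proof (cases "W = {}")
    case True
    then have "col W {}" by (simp add: col_def buildable.empty)
    then show ?thesis by blast
  next
    case False
    from reducible_configuration[OF less.prems False] show ?thesis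
    proof (elim disjE bexE conjE)
      fix v assume v: "v \<in> W" "card (nb W v) \<le> 2"
      let ?W = "W - {v}"
      have "card ?W < card W" using v(1) finW by (intro psubset_card_mono) auto
      then obtain T where "col ?W T" using less.hyps[of ?W] less.prems by blast
      moreover have "nb ?W v = nb W v" using nb_irrefl[of v W] by (auto simp: nb_def)
      ultimately have "\<exists>T'. col (insert v ?W) T'"
        using less.prems v(2) by (intro extend_degree_2) auto
      then show ?thesis using v(1) by (simp add: insert_absorb)
    next
      fix u v w assume u: "u \<in> W" and v: "v \<in> nb W u" and w: "w \<in> nb W u" "w \<noteq> v"
        and deg: "card (nb W u) = 3" "card (nb W v) = 3" "card (nb W w) \<le> 4"
      let ?W = "W - {u, v}"
      have WG: "?W \<subseteq> pverts G" using less.prems by blast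
      have "card ?W < card W" using u finW by (intro psubset_card_mono) auto
      then obtain T where T: "col ?W T" using less.hyps[of ?W] WG by blast
      have vW: "v \<in> W" "(u, v) \<in> parcs G" using v by (auto simp: nb_def)
      have Wu: "nb ?W u = nb (W - {v}) u" using nb_irrefl[of u W] by (auto simp: nb_def)
      have Wv: "nb ?W v = nb (W - {u}) v" using nb_irrefl[of v W] by (auto simp: nb_def)
      have "u \<in> nb W w" using nb_sym[OF u w(1)] .
      then have "card (nb W w) = Suc (card (nb (W - {u}) w))" using nb_remove less.prems by blast
      moreover have "card (nb ?W w) \<le> card (nb (W - {u}) w)"
        using less.prems by (intro card_mono finite_nb) (auto simp: nb_def)
      ultimately have "card (nb ?W w) \<le> 3" using deg(3) by simp
      moreover have "w \<in> nb ?W u" using w nb_irrefl[of u W] by (auto simp: nb_def)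
      moreover have "card (nb ?W u) = 2" using nb_remove[OF v less.prems] deg(1) Wu by simp
      moreover have "card (nb ?W v) = 2" using nb_remove[OF nb_sym[OF u v] less.prems] deg(2) Wv by simp
      ultimately have "\<exists>T'. col (insert u (insert v ?W)) T'"
        using T WG vW(2) by (intro extend_adjacent_3_vertices) auto
      moreover have "insert u (insert v ?W) = W" using u vW(1) by auto
      ultimately show ?thesis by simp
    qed
  qed
qed

lemma coloring_exists: "\<exists>T. transversal G L H T \<and> DP_BA_coloring H T"
proof -
  obtain T where T: "col (pverts G) T" using col_exists by blast
  have "T \<subseteq> pverts H"
  proof
    fix x assume "x \<in> T"
    then have "fst x \<in> pverts G" "snd x \<in> {1, 2, 3}" using T unfolding col_def by auto
    then show "x \<in> pverts H" using H list_eq by (cases x) (auto simp: cover_def)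
  qed
  moreover have "card (T \<inter> ({u} \<times> L u)) = 1" if u: "u \<in> pverts G" for u
  proof -
    obtain x where x: "x \<in> T" "fst x = u" using T u unfolding col_def by (metis imageE)
    then have "snd x \<in> L u" using T u list_eq unfolding col_def by auto
    then have "x \<in> {u} \<times> L u" using x(2) by (simp add: mem_Times_iff)
    moreover have "y = x" if "y \<in> T" "y \<in> {u} \<times> L u" for y
    proof (rule inj_onD[of fst T])
      show "inj_on fst T" using T by (simp add: col_def)
    qed (use that x in \<open>auto simp: mem_Times_iff\<close>)
    ultimately have "T \<inter> ({u} \<times> L u) = {x}" using x(1)
      by blast
    then show ?thesis by simp
  qed
  ultimately have "transversal G L H T" by (auto simp: transversal_def)
  then show ?thesis using T buildable_imp_coloring unfolding col_def by blast
qed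

end

theorem theorem3:
  fixes G :: "'a pair_pre_digraph"
  assumes "pair_graph G"
    and "planar G"
    and "\<not> has_cycle_of_length G 4"
    and "\<not> has_cycle_of_length G 6"
  shows "DP_BA_colorable 3 G"
  unfolding DP_BA_colorable_def
proof (intro allI impI)
  fix L H assume "assignment 3 G L \<and> cover G L H"
  then interpret planar_three_cover G L H
    using assms by (intro planar_three_cover.intro three_cover.intro planar_three_cover_axioms.intro) auto
  show "\<exists>T. transversal G L H T \<and> DP_BA_coloring H T" by (rule coloring_exists)
qed

end
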